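(* Let $(X_1,Y_1)\sim p_1$ and $(X_2,Y_2)\sim p_2$ be independent pairs of random variables, where $X_1,X_2$ take values in $\{0,1\}$ and $Y_1,Y_2$ take values in finite sets, and let $X_1+X_2$ be the sum modulo 2. For $\alpha\in(0,\tfrac13]\cup[\tfrac12,\infty)$, $$H^A_\alpha(X_2|X_1+X_2,Y_1Y_2)\le H^A_\alpha(X_1|Y_1)+H^A_\alpha(X_2|Y_2)-h_{1/\alpha}\Big(h_{1/\alpha}^{-1}\big(H^A_\alpha(X_1|Y_1)\big)\ast h_{1/\alpha}^{-1}\big(H^A_\alpha(X_2|Y_2)\big)\Big).$$ For $\alpha\in[\tfrac13,\tfrac12]$ the same holds with $\le$ replaced by $\ge$; in particular, for $\alpha\in\{\tfrac13,\tfrac12\}$ equality holds. These bounds are tight in the sense that equality is achieved when both $(X_1,Y_1)$ and $(X_2,Y_2)$ are given by binary symmetric channels.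
   Context: For a joint distribution $p(x,y)$ on a finite product set and $\alpha\in(0,\infty)\setminus\{1\}$, the Arimoto conditional Rényi entropy is $$H^A_\alpha(X|Y)=\frac{\alpha}{1-\alpha}\log\sum_y p(y)\Big(\sum_x p(x|y)^\alpha\Big)^{1/\alpha},$$ with $\log$ the natural logarithm, $0^\alpha=0$ and terms with $p(y)=0$ omitted; for $\alpha=1$ it is defined as the limit $\alpha\to1$, i.e. the conditional Shannon entropy $H(X|Y)$. $H^A_\alpha(X_2|X_1+X_2,Y_1Y_2)$ is the entropy of $X_2$ conditioned on the triple $(X_1+X_2,Y_1,Y_2)$. For $\beta>0$, $\beta\ne1$, $h_\beta(t)=\frac{1}{1-\beta}\log\big(t^\beta+(1-t)^\beta\big)$ is the binary Rényi entropy on $[0,1]$ ($h_1$ is the binary Shannon entropy), and $h_\beta^{-1}:[0,\log 2]\to[0,\tfrac12]$ is the inverse of the restriction of $h_\beta$ to $[0,\tfrac12]$. The binary convolution is $a\ast b=a(1-b)+(1-a)b$. A pair $(X,Y)$ is given by a binary symmetric channel if $X$ is uniform on $\{0,1\}$ and $Y=X\oplus N$ with $N\in\{0,1\}$ independent of $X$ and $\Pr[N=1]=\varepsilon$ for some $\varepsilon\in[0,1]$. *)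

theory Defs
  imports "HOL-Probability.Probability" "HOL-Library.Z2"
begin

instance bit :: finite
proof
  have "(UNIV :: bit set) \<subseteq> {0, 1}"
    using bit_not_zero_iff by blast
  then show "finite (UNIV :: bit set)"
    by (rule finite_subset) simp
qed

definition marginal_snd :: "('x \<times> 'y) pmf \<Rightarrow> 'y \<Rightarrow> real" where
  "marginal_snd p y = pmf (map_pmf snd p) y"

definition cond_prob :: "('x \<times> 'y) pmf \<Rightarrow> 'x \<Rightarrow> 'y \<Rightarrow> real" where
  "cond_prob p x y = pmf p (x, y) / marginal_snd p y"

text \<open>
  Isabelle's conventions \<open>0 powr a = 0\<close> and \<open>0 * ln 0 = 0\<close> are the ones needed below.
  The value at \<open>\<alpha> = 1\<close> is the conditional Shannon entropy; the lemmas
  \<open>arimoto_entropy_tendsto_1\<close> and \<open>arimoto_entropy_1_eq_conditional_entropy\<close> show that it is the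
  limit of the other values and that it agrees with the library's conditional entropy in nats.
\<close>

definition arimoto_entropy :: "real \<Rightarrow> ('x::finite \<times> 'y::finite) pmf \<Rightarrow> real" where
  "arimoto_entropy \<alpha> p =
     (if \<alpha> = 1
      then - (\<Sum>y | marginal_snd p y > 0. marginal_snd p y *
               (\<Sum>x\<in>UNIV. cond_prob p x y * ln (cond_prob p x y)))
      else \<alpha> / (1 - \<alpha>) *
             ln (\<Sum>y | marginal_snd p y > 0. marginal_snd p y *
                   (\<Sum>x\<in>UNIV. cond_prob p x y powr \<alpha>) powr (1 / \<alpha>)))"

lemma marginal_snd_eq_sum:
  fixes p :: "('x::finite \<times> 'y::finite) pmf"
  shows "marginal_snd p y = (\<Sum>x\<in>UNIV. pmf p (x, y))"
proof -
  have "marginal_snd p y = measure p (snd -` {y})"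
    by (simp add: marginal_snd_def pmf_map)
  also have "\<dots> = (\<Sum>z\<in>snd -` {y}. pmf p z)"
    by (rule measure_measure_pmf_finite) simp
  also have "\<dots> = (\<Sum>x\<in>UNIV. pmf p (x, y))"
    by (rule sum.reindex_bij_witness[of _ "\<lambda>x. (x, y)" fst]) auto
  finally show ?thesis .
qed

lemma sum_cond_prob:
  fixes p :: "('x::finite \<times> 'y::finite) pmf"
  assumes "marginal_snd p y > 0"
  shows "(\<Sum>x\<in>UNIV. cond_prob p x y) = 1"
  using assms by (simp add: cond_prob_def marginal_snd_eq_sum flip: sum_divide_distrib)

lemma sum_marginal_snd:
  fixes p :: "('x::finite \<times> 'y::finite) pmf"
  shows "(\<Sum>y | marginal_snd p y > 0. marginal_snd p y) = 1"
proof -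
  have "(\<Sum>y | marginal_snd p y > 0. marginal_snd p y) = (\<Sum>y\<in>UNIV. marginal_snd p y)"
    by (rule sum.mono_neutral_left) (auto simp: marginal_snd_def not_less order_antisym)
  also have "\<dots> = 1"
    unfolding marginal_snd_def by (rule sum_pmf_eq_1) auto
  finally show ?thesis .
qed

lemma DERIV_powr_exponent:
  fixes q :: real
  assumes "q \<ge> 0"
  shows "((\<lambda>a. q powr a) has_real_derivative q * ln q) (at 1)"
proof (cases "q = 0")
  case False
  then show ?thesis
    using assms by (auto intro!: derivative_eq_intros simp: powr_def)
qed simp

lemma arimoto_entropy_tendsto_1:
  fixes p :: "('x::finite \<times> 'y::finite) pmf"
  shows "((\<lambda>\<alpha>. arimoto_entropy \<alpha> p) \<longlongrightarrow> arimoto_entropy 1 p) (at 1)"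
proof -
  define Y where "Y = {y. marginal_snd p y > 0}"
  define G where "G = (\<lambda>a. \<Sum>y\<in>Y. marginal_snd p y *
                     (\<Sum>x\<in>UNIV. cond_prob p x y powr a) powr (1 / a))"
  define D where "D = (\<Sum>y\<in>Y. marginal_snd p y *
                     (\<Sum>x\<in>UNIV. cond_prob p x y * ln (cond_prob p x y)))"
  have cp: "cond_prob p x y \<ge> 0" for x y
    by (simp add: cond_prob_def marginal_snd_def)
  have sum1: "(\<Sum>x\<in>UNIV. cond_prob p x y powr 1) = 1" if "y \<in> Y" for y
    using sum_cond_prob[of p y] that cp by (simp add: Y_def)
  have inner: "((\<lambda>a. (\<Sum>x\<in>UNIV. cond_prob p x y powr a) powr (1 / a)) has_real_derivative
                 (\<Sum>x\<in>UNIV. cond_prob p x y * ln (cond_prob p x y))) (at 1)" if y: "y \<in> Y" for y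
  proof -
    have s: "((\<lambda>a. \<Sum>x\<in>UNIV. cond_prob p x y powr a) has_real_derivative
               (\<Sum>x\<in>UNIV. cond_prob p x y * ln (cond_prob p x y))) (at 1)"
      by (intro DERIV_sum DERIV_powr_exponent cp)
    have r: "((\<lambda>a. 1 / a) has_real_derivative - 1) (at (1::real))"
      by (auto intro!: derivative_eq_intros)
    show ?thesis
      using DERIV_powr[OF s _ r] sum1[OF y] by simp
  qed
  have G1: "G 1 = 1"
    using sum_marginal_snd[of p] sum1 unfolding G_def Y_def by simp
  have "(G has_real_derivative D) (at 1)"
    unfolding G_def D_def by (intro DERIV_sum DERIV_cmult inner)
  then have "((\<lambda>a. ln (G a)) has_real_derivative D) (at 1)"
    using DERIV_ln[of "G 1"] by (auto intro!: derivative_eq_intros simp: G1)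
  then have "((\<lambda>a. ln (G a) / (a - 1)) \<longlongrightarrow> D) (at 1)"
    by (simp add: has_field_derivative_iff G1)
  then have "((\<lambda>a. - a * (ln (G a) / (a - 1))) \<longlongrightarrow> - 1 * D) (at 1)"
    by (intro tendsto_intros)
  moreover have "\<forall>\<^sub>F a in at 1. - a * (ln (G a) / (a - 1)) = arimoto_entropy a p"
    unfolding eventually_at_filter
    by (rule always_eventually)
      (auto simp: arimoto_entropy_def G_def Y_def divide_simps, (simp add: algebra_simps)?)
  ultimately show ?thesis
    by (simp add: arimoto_entropy_def D_def Y_def tendsto_cong)
qed

lemma arimoto_entropy_1_eq_conditional_entropy:
  fixes p :: "('x::finite \<times> 'y::finite) pmf"
  shows "arimoto_entropy 1 p =
    prob_space.conditional_entropy (measure_pmf p) (exp 1) (count_space UNIV) (count_space UNIV) fst snd"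
proof -
  interpret information_space "measure_pmf p" "exp 1"
    by unfold_locales (auto simp: one_less_exp_iff)
  have fstU: "fst ` space (measure_pmf p) = UNIV" and sndU: "snd ` space (measure_pmf p) = UNIV"
    by (auto simp: surj_def image_iff)
  have sy: "simple_distributed (measure_pmf p) snd (marginal_snd p)"
    by (rule measure_pmf.simple_distributedI) (auto simp: marginal_snd_def simple_function_def pmf_map)
  have sxy: "simple_distributed (measure_pmf p) (\<lambda>z. (fst z, snd z)) (pmf p)"
    by (rule measure_pmf.simple_distributedI) (auto simp: simple_function_def measure_pmf_single pmf_nonneg)
  have "prob_space.conditional_entropy (measure_pmf p) (exp 1) (count_space UNIV) (count_space UNIV) fst snd =
      - (\<Sum>(x, y)\<in>UNIV. pmf p (x, y) * ln (pmf p (x, y) / marginal_snd p y))"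
    using conditional_entropy_eq[OF sy sxy] by (simp add: fstU sndU log_def split_beta)
  also have "\<dots> = - (\<Sum>y\<in>UNIV. \<Sum>x\<in>UNIV. pmf p (x, y) * ln (cond_prob p x y))"
    unfolding cond_prob_def sum.cartesian_product[symmetric] UNIV_Times_UNIV[symmetric]
    by (subst sum.swap) simp
  also have "\<dots> = - (\<Sum>y | marginal_snd p y > 0. \<Sum>x\<in>UNIV. pmf p (x, y) * ln (cond_prob p x y))"
    by (intro arg_cong[of _ _ uminus] sum.mono_neutral_right)
      (auto simp: cond_prob_def marginal_snd_def not_less order_antisym)
  also have "\<dots> = arimoto_entropy 1 p"
    unfolding arimoto_entropy_def sum_distrib_left
    by (auto intro!: sum.cong simp: cond_prob_def)
  finally show ?thesis by simp
qed

definition binary_renyi :: "real \<Rightarrow> real \<Rightarrow> real" where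
  "binary_renyi \<beta> t =
     (if \<beta> = 1 then - t * ln t - (1 - t) * ln (1 - t)
      else 1 / (1 - \<beta>) * ln (t powr \<beta> + (1 - t) powr \<beta>))"

text \<open>
  For \<open>\<beta> > 0\<close>, \<^term>\<open>binary_renyi \<beta>\<close> maps \<open>[0, 1/2]\<close> bijectively onto \<open>[0, ln 2]\<close>; the
  inverse is unspecified outside \<open>[0, ln 2]\<close>.
\<close>

definition binary_renyi_inv :: "real \<Rightarrow> real \<Rightarrow> real" where
  "binary_renyi_inv \<beta> = the_inv_into {0..1/2} (binary_renyi \<beta>)"

definition binary_conv :: "real \<Rightarrow> real \<Rightarrow> real" (infixl "\<star>" 70) where
  "a \<star> b = a * (1 - b) + (1 - a) * b"

text \<open>
  The joint law of \<open>X\<^sub>2\<close> and the triple \<open>(X\<^sub>1 + X\<^sub>2, Y\<^sub>1, Y\<^sub>2)\<close>, where the pairs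
  \<open>(X\<^sub>1, Y\<^sub>1)\<close> and \<open>(X\<^sub>2, Y\<^sub>2)\<close> are independent with laws \<open>p\<^sub>1\<close> and \<open>p\<^sub>2\<close>; addition
  on \<^typ>\<open>bit\<close> is modulo 2.
\<close>

definition sum_law :: "(bit \<times> 'b) pmf \<Rightarrow> (bit \<times> 'c) pmf \<Rightarrow> (bit \<times> (bit \<times> 'b \<times> 'c)) pmf" where
  "sum_law p1 p2 =
     map_pmf (\<lambda>((x1, y1), (x2, y2)). (x2, (x1 + x2, y1, y2))) (pair_pmf p1 p2)"

text \<open>The law of \<open>(X, X + N)\<close> for \<open>X\<close> uniform and \<open>N\<close> independent of \<open>X\<close> with \<open>Pr[N = 1] = \<epsilon>\<close>.\<close>

definition bsc_law :: "real \<Rightarrow> (bit \<times> bit) pmf" where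
  "bsc_law \<epsilon> = map_pmf (\<lambda>(x, n). (x, x + n))
     (pair_pmf (pmf_of_set UNIV) (map_pmf of_bool (bernoulli_pmf \<epsilon>)))"

end

(*
  Put \<beta> = 1 / \<alpha>, and for a value y let a, b be the \<alpha>-th powers of p(0,y), p(1,y).
  Reweighting the values y proportionally to (a + b)^\<beta> and setting c = (a - b) / (a + b), the
  entropy becomes a decreasing function of the mean of F(c), where F is a normalisation of
  (1 + c)^\<beta> + (1 - c)^\<beta>, and the entropy of the sum is the sum of the entropies minus the
  same function of the mean of F(c1 c2).  The bound is thus Jensen's inequality, used once in each
  variable, for F(c) \<mapsto> F(k c) with 0 <= k <= 1.  This map is concave or convex according to
  whether the elasticity of F' is increasing or decreasing.  With m = \<beta> - 1 and c = tanh s,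
  twice the elasticity is m + m sinh((2 - m) s) / sinh(m s), whose direction of monotonicity is
  the sign of (1 - m) (2 - m) = (2 - \<beta>) (3 - \<beta>).
*)
theory Submission
  imports Defs
begin

section \<open>Monotone elasticity\<close>

text \<open>
  The value at \<open>m = 0\<close> is the limit; it corresponds to the Shannon case.
\<close>

definition sinh_quot :: "real \<Rightarrow> real \<Rightarrow> real" where
  "sinh_quot m s = (if m = 0 then s else sinh (m * s) / m)"

lemma sinh_quot_0 [simp]: "sinh_quot m 0 = 0"
  by (simp add: sinh_quot_def)

lemma sinh_quot_pos: "s > 0 \<Longrightarrow> sinh_quot m s > 0"
  by (cases m "0::real" rule: linorder_cases)
    (auto simp: sinh_quot_def divide_neg_neg mult_neg_pos)

lemma mult_sinh_quot: "m * sinh_quot m s = sinh (m * s)"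
  by (simp add: sinh_quot_def)

lemma DERIV_sinh_quot: "(sinh_quot m has_real_derivative cosh (m * s)) (at s)"
proof (cases "m = 0")
  case True
  then have "sinh_quot m = (\<lambda>s. s)" by (auto simp: sinh_quot_def)
  then show ?thesis using True by simp
next
  case False
  then have "sinh_quot m = (\<lambda>s. sinh (m * s) / m)" by (auto simp: sinh_quot_def)
  then show ?thesis using False by (auto intro!: derivative_eq_intros)
qed

text \<open>
  The factor \<open>\<sigma>\<close> is used with the values \<open>1\<close> and
  \<open>-1\<close>, for the two directions of the inequality.
\<close>

lemma sinh_ratio_numerator_nonneg:
  fixes \<sigma> m s :: real
  assumes \<sigma>: "\<sigma> * ((1 - m) * (2 - m)) \<ge> 0" and s: "s \<ge> 0"
  shows "\<sigma> * ((2 - m) * cosh ((2 - m) * s) * sinh_quot m s - sinh ((2 - m) * s) * cosh (m * s)) \<ge> 0"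
proof -
  define N where "N = (\<lambda>s. \<sigma> * ((2 - m) * cosh ((2 - m) * s) * sinh_quot m s
                              - sinh ((2 - m) * s) * cosh (m * s)))"
  have der: "(N has_real_derivative
               4 * (\<sigma> * ((1 - m) * (2 - m))) * sinh_quot (2 - m) t * sinh_quot m t) (at t)" for t
  proof -
    have "(N has_real_derivative
       \<sigma> * ((2 - m) * (sinh ((2 - m) * t) * (2 - m)) * sinh_quot m t - sinh ((2 - m) * t) * (sinh (m * t) * m))) (at t)"
      unfolding N_def
      by (auto intro!: derivative_eq_intros DERIV_sinh_quot simp: algebra_simps)
    \<comment> \<open>The products of hyperbolic cosines have already cancelled. The rest carries (2
      - m)^2 - m^2 = 4 (1 - m), and with both sines written through \<open>sinh_quot\<close>, which
      is nonnegative at nonnegative arguments whatever its parameter, only the sign of (1 - m) (2 -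
      m) matters.\<close>
    also have "\<sigma> * ((2 - m) * (sinh ((2 - m) * t) * (2 - m)) * sinh_quot m t - sinh ((2 - m) * t) * (sinh (m * t) * m))
      = 4 * (\<sigma> * ((1 - m) * (2 - m))) * sinh_quot (2 - m) t * sinh_quot m t"
      unfolding mult_sinh_quot[symmetric] by (simp add: algebra_simps)
    finally show ?thesis .
  qed
  have pos: "sinh_quot a t \<ge> 0" if "t \<ge> 0" for a t
    using sinh_quot_pos[of t a] that by (cases "t = 0") auto
  have "N 0 \<le> N s"
    by (rule DERIV_nonneg_imp_nondecreasing[OF s])
      (use \<sigma> in \<open>auto intro!: exI[of _ "4 * (\<sigma> * ((1 - m) * (2 - m))) * sinh_quot (2 - m) _ * sinh_quot m _"] der mult_nonneg_nonneg pos\<close>)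
  then show ?thesis by (simp add: N_def)
qed

text \<open>The quotient rule leaves the expression of \<open>sinh_ratio_numerator_nonneg\<close>
  over a positive square. This ratio is the only varying term of the elasticity in
  \<open>slope_elasticity_tanh\<close>.\<close>

lemma sinh_ratio_monotone:
  fixes \<sigma> m s t :: real
  assumes \<sigma>: "\<sigma> * ((1 - m) * (2 - m)) \<ge> 0" and "0 < s" "s \<le> t"
  shows "\<sigma> * (sinh ((2 - m) * s) / sinh_quot m s) \<le> \<sigma> * (sinh ((2 - m) * t) / sinh_quot m t)"
proof (rule DERIV_nonneg_imp_nondecreasing[OF \<open>s \<le> t\<close>])
  fix x assume x: "s \<le> x" "x \<le> t"
  have S: "sinh_quot m x > 0" using assms x by (intro sinh_quot_pos) auto
  have "((\<lambda>x. \<sigma> * (sinh ((2 - m) * x) / sinh_quot m x)) has_real_derivative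
     \<sigma> * ((2 - m) * cosh ((2 - m) * x) * sinh_quot m x - sinh ((2 - m) * x) * cosh (m * x))
       / (sinh_quot m x)\<^sup>2) (at x)"
    using S by (auto intro!: derivative_eq_intros DERIV_sinh_quot simp: power2_eq_square algebra_simps)
  moreover have "\<sigma> * ((2 - m) * cosh ((2 - m) * x) * sinh_quot m x - sinh ((2 - m) * x) * cosh (m * x))
       / (sinh_quot m x)\<^sup>2 \<ge> 0"
    using sinh_ratio_numerator_nonneg[OF \<sigma>, of x] assms x by simp
  ultimately show "\<exists>y. ((\<lambda>x. \<sigma> * (sinh ((2 - m) * x) / sinh_quot m x)) has_real_derivative y) (at x) \<and> 0 \<le> y"
    by blast
qed

section \<open>The slope function and its elasticity\<close>

text \<open>This is the derivative of \<open>renyi_fun\<close> with exponent m + 1, as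
  \<open>DERIV_renyi_fun\<close> shows; the value at m = 0 is the limit of the other branch.\<close>

definition renyi_slope :: "real \<Rightarrow> real \<Rightarrow> real" where
  "renyi_slope m c = (if m = 0 then ln (1 + c) - ln (1 - c)
                      else ((1 + c) powr m - (1 - c) powr m) / m)"

lemma DERIV_renyi_slope:
  assumes "\<bar>c\<bar> < 1"
  shows "(renyi_slope m has_real_derivative (1 + c) powr (m - 1) + (1 - c) powr (m - 1)) (at c)"
proof -
  have c: "1 + c > 0" "1 - c > 0" using assms by auto
  show ?thesis
  proof (cases "m = 0")
    case True
    then have "renyi_slope m = (\<lambda>c. ln (1 + c) - ln (1 - c))" by (auto simp: renyi_slope_def)
    then show ?thesis using True c
      by (auto intro!: derivative_eq_intros simp: powr_minus_divide)
  next
    case False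
    then have "renyi_slope m = (\<lambda>c. ((1 + c) powr m - (1 - c) powr m) / m)" by (auto simp: renyi_slope_def)
    then show ?thesis using False c
      by (auto intro!: derivative_eq_intros simp: field_simps)
  qed
qed

lemma one_pm_tanh:
  fixes s :: real
  shows "1 + tanh s = exp s / cosh s" "1 - tanh s = exp (- s) / cosh s"
  by (simp_all add: tanh_def field_simps cosh_plus_sinh cosh_minus_sinh)

text \<open>Since 1 + tanh s and 1 - tanh s are exp s and exp (- s) divided by cosh s, powers become
  exponentials and their difference a hyperbolic sine.\<close>

lemma renyi_slope_tanh: "renyi_slope m (tanh s) = 2 * sinh_quot m s / cosh s powr m"
proof -
  have "ln (exp s / cosh s) - ln (exp (- s) / cosh s) = 2 * s"
    by (simp add: ln_div)
  moreover have "(exp s / cosh s) powr m - (exp (- s) / cosh s) powr m = 2 * sinh (m * s) / cosh s powr m"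
    by (simp add: powr_divide exp_powr_real sinh_def field_simps)
  ultimately show ?thesis
    by (simp add: renyi_slope_def sinh_quot_def one_pm_tanh)
qed

lemma tanh_obtain:
  fixes c :: real
  assumes "0 < c" "c < 1"
  obtains s where "s > 0" "c = tanh s"
proof
  show "artanh c > 0" using assms by (simp add: artanh_def)
  have "exp (- 2 * artanh c) = (1 - c) / (1 + c)"
    using assms by (simp add: artanh_def exp_minus field_simps)
  then show "c = tanh (artanh c)" using assms unfolding tanh_real_altdef
    by (simp only:) (simp add: field_simps)
qed

lemma renyi_slope_pos:
  assumes "0 < c" "c < 1"
  shows "renyi_slope m c > 0"
  using tanh_obtain[OF assms] by (metis renyi_slope_tanh sinh_quot_pos cosh_real_pos powr_gt_zero
    divide_pos_pos mult_pos_pos zero_less_numeral less_irrefl)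

text \<open>With q = \<open>renyi_slope m\<close> this is c q'(c) / q(c), the derivative of ln q
  with respect to ln c.\<close>

definition slope_elasticity :: "real \<Rightarrow> real \<Rightarrow> real" where
  "slope_elasticity m c = c * ((1 + c) powr (m - 1) + (1 - c) powr (m - 1)) / renyi_slope m c"

lemma slope_elasticity_tanh:
  assumes "s > 0"
  shows "slope_elasticity m (tanh s) = (m + sinh ((2 - m) * s) / sinh_quot m s) / 2"
proof -
  have S: "sinh_quot m s > 0" using sinh_quot_pos[OF assms] .
  have "(exp s / cosh s) powr (m - 1) + (exp (- s) / cosh s) powr (m - 1)
       = 2 * cosh ((m - 1) * s) * cosh s / cosh s powr m"
  proof -
    have "exp (s * (m - 1)) + exp (- (s * (m - 1))) = 2 * cosh ((m - 1) * s)"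
      by (simp add: cosh_def mult.commute)
    then show ?thesis
      by (simp add: powr_divide exp_powr_real powr_diff[of "cosh s"] flip: add_divide_distrib distrib_right)
  qed
  then have "slope_elasticity m (tanh s) = sinh s * cosh ((m - 1) * s) / sinh_quot m s"
    using S by (simp add: slope_elasticity_def one_pm_tanh renyi_slope_tanh) (simp add: tanh_def field_simps)
  \<comment> \<open>After this product-to-sum formula, sinh (m s) = m \<open>sinh_quot m s\<close>
    contributes just the constant m / 2.\<close>
  also have "sinh s * cosh ((m - 1) * s) = (sinh (m * s) + sinh ((2 - m) * s)) / 2"
    using sinh_add[of s "(m - 1) * s"] sinh_diff[of s "(m - 1) * s"]
    by (simp add: algebra_simps)
  finally show ?thesis using S by (simp add: mult_sinh_quot[symmetric] field_simps)
qed

lemma slope_elasticity_monotone: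
  fixes \<sigma> m x y :: real
  assumes \<sigma>: "\<sigma> * ((1 - m) * (2 - m)) \<ge> 0" and xy: "0 < x" "x \<le> y" "y < 1"
  shows "\<sigma> * slope_elasticity m x \<le> \<sigma> * slope_elasticity m y"
proof -
  obtain s where s: "s > 0" "x = tanh s" using tanh_obtain[of x] xy by auto
  obtain t where t: "t > 0" "y = tanh t" using tanh_obtain[of y] xy by auto
  have "s \<le> t" using xy s t by simp
  then show ?thesis
    using sinh_ratio_monotone[OF \<sigma>, of s t] s t by (simp add: slope_elasticity_tanh distrib_left add_divide_distrib)
qed

text \<open>With q the slope and e its elasticity, the logarithmic derivative of q(k t) / q(t) is
  (e(k t) - e(t)) / t, and k t \<le> t. Up to the factor k, the ratio is the derivative of F(k c)
  with respect to F(c), so its monotonicity decides between concavity and convexity.\<close>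

lemma renyi_slope_ratio_antimono:
  fixes \<sigma> m k x y :: real
  assumes \<sigma>: "\<sigma> * ((1 - m) * (2 - m)) \<ge> 0" and k: "0 < k" "k \<le> 1" and xy: "0 < x" "x \<le> y" "y < 1"
  shows "\<sigma> * (renyi_slope m (k * y) / renyi_slope m y) \<le> \<sigma> * (renyi_slope m (k * x) / renyi_slope m x)"
proof (rule DERIV_nonpos_imp_nonincreasing[OF \<open>x \<le> y\<close>])
  fix t assume t: "x \<le> t" "t \<le> y"
  define A where "A = (\<lambda>c::real. (1 + c) powr (m - 1) + (1 - c) powr (m - 1))"
  define q where "q = renyi_slope m"
  have t01: "0 < t" "t < 1" using t xy by auto
  have kt: "0 < k * t" "k * t \<le> t" "k * t < 1" using t01 k by (auto simp: mult_le_cancel_right1 intro: le_less_trans[of _ t])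
  have pos: "q t > 0" "q (k * t) > 0"
    unfolding q_def using t01 kt by (auto intro!: renyi_slope_pos)
  have d1: "(q has_real_derivative A t) (at t)"
    unfolding A_def q_def using t01 by (intro DERIV_renyi_slope) auto
  have "(q has_real_derivative A (k * t)) (at (k * t))"
    unfolding A_def q_def using kt by (intro DERIV_renyi_slope) auto
  then have d2: "((\<lambda>t. q (k * t)) has_real_derivative A (k * t) * k) (at t)"
    by (rule DERIV_chain2) (auto intro!: derivative_eq_intros)
  have "((\<lambda>t. \<sigma> * (q (k * t) / q t)) has_real_derivative
      \<sigma> * ((A (k * t) * k * q t - q (k * t) * A t) / (q t * q t))) (at t)"
    using pos by (intro DERIV_cmult DERIV_divide d1 d2) auto
  moreover have "\<sigma> * ((A (k * t) * k * q t - q (k * t) * A t) / (q t * q t))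
      = q (k * t) / (q t * t) * (\<sigma> * slope_elasticity m (k * t) - \<sigma> * slope_elasticity m t)"
  proof -
    have E: "slope_elasticity m c = c * A c / q c" for c
      by (simp add: slope_elasticity_def A_def q_def)
    show ?thesis using pos t01 by (simp add: E field_simps)
  qed
  moreover have "\<dots> \<le> 0"
    using slope_elasticity_monotone[OF \<sigma>, of "k * t" t] kt t01 pos
    by (intro mult_nonneg_nonpos) auto
  ultimately show "\<exists>d. ((\<lambda>t. \<sigma> * (renyi_slope m (k * t) / renyi_slope m t)) has_real_derivative d) (at t) \<and> d \<le> 0"
    unfolding q_def by metis
qed

section \<open>Jensen's inequality\<close>

text \<open>Only the point 0 needs a limit argument. The lemma gives continuity of
  \<open>renyi_fun 1\<close> up to the biases 1 and -1.\<close>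

lemma continuous_on_x_ln_x: "continuous_on {0..} (\<lambda>x::real. x * ln x)"
  unfolding continuous_on_eq_continuous_within
proof
  fix x :: real assume "x \<in> {0..}"
  show "continuous (at x within {0..}) (\<lambda>x. x * ln x)"
  proof (cases "x = 0")
    case True
    have "((\<lambda>x::real. x * ln x) \<longlongrightarrow> 0) (at_right 0)" by real_asymp
    then show ?thesis
      using True by (simp add: continuous_within at_within_Ici_at_right)
  next
    case False
    then show ?thesis by (intro continuous_intros)
  qed
qed

text \<open>
  Up to constants these are \<open>t^\<beta> + (1 - t)^\<beta>\<close> and minus the binary
  Shannon entropy at \<open>t = (1 - c) / 2\<close>, signed so that the function increases on
  \<open>[0, 1]\<close> for every \<open>\<beta> > 0\<close>.
\<close>

definition renyi_fun :: "real \<Rightarrow> real \<Rightarrow> real" where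
  "renyi_fun \<beta> c = (if \<beta> = 1 then (1 + c) * ln (1 + c) + (1 - c) * ln (1 - c)
                    else ((1 + c) powr \<beta> + (1 - c) powr \<beta>) / (\<beta> * (\<beta> - 1)))"

lemma renyi_fun_minus [simp]: "renyi_fun \<beta> (- c) = renyi_fun \<beta> c"
  by (simp add: renyi_fun_def)

lemma renyi_fun_abs [simp]: "renyi_fun \<beta> \<bar>c\<bar> = renyi_fun \<beta> c"
  by (simp add: abs_if)

lemma DERIV_renyi_fun:
  assumes "\<bar>c\<bar> < 1" "\<beta> > 0"
  shows "(renyi_fun \<beta> has_real_derivative renyi_slope (\<beta> - 1) c) (at c)"
proof -
  have c: "1 + c > 0" "1 - c > 0" using assms by auto
  show ?thesis
  proof (cases "\<beta> = 1")
    case True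
    then have "renyi_fun \<beta> = (\<lambda>c. (1 + c) * ln (1 + c) + (1 - c) * ln (1 - c))"
      by (auto simp: renyi_fun_def)
    then show ?thesis using True c
      by (auto intro!: derivative_eq_intros simp: renyi_slope_def)
  next
    case False
    then have "renyi_fun \<beta> = (\<lambda>c. ((1 + c) powr \<beta> + (1 - c) powr \<beta>) / (\<beta> * (\<beta> - 1)))"
      by (auto simp: renyi_fun_def)
    moreover have "((\<lambda>c. ((1 + c) powr \<beta> + (1 - c) powr \<beta>) / (\<beta> * (\<beta> - 1))) has_real_derivative
        (\<beta> * (1 + c) powr (\<beta> - 1) - \<beta> * (1 - c) powr (\<beta> - 1)) / (\<beta> * (\<beta> - 1))) (at c)"
      using False c assms by (auto intro!: derivative_eq_intros)
    moreover have "(\<beta> * (1 + c) powr (\<beta> - 1) - \<beta> * (1 - c) powr (\<beta> - 1)) / (\<beta> * (\<beta> - 1)) = renyi_slope (\<beta> - 1) c"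
      using False assms by (simp add: renyi_slope_def flip: right_diff_distrib)
    ultimately show ?thesis by simp
  qed
qed

lemma continuous_on_renyi_fun:
  assumes "\<beta> > 0"
  shows "continuous_on {-1..1} (renyi_fun \<beta>)"
proof (cases "\<beta> = 1")
  case True
  then have eq: "renyi_fun \<beta> = (\<lambda>c. (1 + c) * ln (1 + c) + (1 - c) * ln (1 - c))"
    by (auto simp: renyi_fun_def)
  have "continuous_on {-1..1::real} (\<lambda>c. (1 + c) * ln (1 + c))"
    by (rule continuous_on_compose2[OF continuous_on_x_ln_x]) (auto intro!: continuous_intros)
  moreover have "continuous_on {-1..1::real} (\<lambda>c. (1 - c) * ln (1 - c))"
    by (rule continuous_on_compose2[OF continuous_on_x_ln_x]) (auto intro!: continuous_intros)
  ultimately show ?thesis unfolding eq by (rule continuous_on_add)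
next
  case False
  then have "renyi_fun \<beta> = (\<lambda>c. ((1 + c) powr \<beta> + (1 - c) powr \<beta>) / (\<beta> * (\<beta> - 1)))"
    by (auto simp: renyi_fun_def)
  then show ?thesis using assms False
    by (auto intro!: continuous_intros continuous_on_powr')
qed

text \<open>The positive derivative is needed only in the open interval: it vanishes at 0 and may be
  infinite at 1, and continuity takes care of both ends.\<close>

lemma renyi_fun_strict_mono:
  assumes "\<beta> > 0" "0 \<le> x" "x < y" "y \<le> 1"
  shows "renyi_fun \<beta> x < renyi_fun \<beta> y"
proof (rule DERIV_pos_imp_increasing_open[OF \<open>x < y\<close>])
  fix t assume "x < t" "t < y"
  then show "\<exists>d. (renyi_fun \<beta> has_real_derivative d) (at t) \<and> d > 0"
    using assms by (intro exI[of _ "renyi_slope (\<beta> - 1) t"] conjI DERIV_renyi_fun renyi_slope_pos) auto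
qed (use assms in \<open>auto intro: continuous_on_subset[OF continuous_on_renyi_fun]\<close>)

lemma renyi_fun_le_iff:
  assumes "\<beta> > 0" "x \<in> {0..1}" "y \<in> {0..1}"
  shows "renyi_fun \<beta> x \<le> renyi_fun \<beta> y \<longleftrightarrow> x \<le> y"
  using renyi_fun_strict_mono[of \<beta> x y] renyi_fun_strict_mono[of \<beta> y x] assms
  by (cases x y rule: linorder_cases) auto

lemma renyi_fun_eq_iff:
  assumes "\<beta> > 0" "x \<in> {0..1}" "y \<in> {0..1}"
  shows "renyi_fun \<beta> x = renyi_fun \<beta> y \<longleftrightarrow> x = y"
  using renyi_fun_le_iff[OF assms] renyi_fun_le_iff[OF assms(1,3,2)] by auto

text \<open>
  A supporting line of \<open>F(c) \<mapsto> F(k c)\<close> at \<open>F(\<gamma>)\<close>; its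
  slope \<open>r\<close> is the derivative of that map.
\<close>

lemma renyi_fun_support:
  fixes \<sigma> \<beta> k \<gamma> c :: real
  assumes \<sigma>: "\<sigma> * ((2 - \<beta>) * (3 - \<beta>)) \<ge> 0" and \<beta>: "\<beta> > 0"
    and k: "0 < k" "k \<le> 1" and \<gamma>: "0 < \<gamma>" "\<gamma> < 1" and c: "0 \<le> c" "c \<le> 1"
  defines "r \<equiv> k * (renyi_slope (\<beta> - 1) (k * \<gamma>) / renyi_slope (\<beta> - 1) \<gamma>)"
  shows "\<sigma> * (renyi_fun \<beta> (k * c) - renyi_fun \<beta> (k * \<gamma>)) \<le> \<sigma> * (r * (renyi_fun \<beta> c - renyi_fun \<beta> \<gamma>))"
proof -
  define m where "m = \<beta> - 1"
  have \<sigma>': "\<sigma> * ((1 - m) * (2 - m)) \<ge> 0" using \<sigma> by (simp add: m_def)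
  \<comment> \<open>The claim is D c \<le> D \<gamma>. The derivative d is a positive factor times
    the difference of the \<open>\<sigma>\<close>-signed slope ratios at t and at \<gamma>, so D
    rises up to \<gamma> and falls after it.\<close>
  define D where "D = (\<lambda>t. \<sigma> * (renyi_fun \<beta> (k * t) - r * renyi_fun \<beta> t))"
  define d where "d = (\<lambda>t. k * renyi_slope m t * (\<sigma> * (renyi_slope m (k * t) / renyi_slope m t) -
                              \<sigma> * (renyi_slope m (k * \<gamma>) / renyi_slope m \<gamma>)))"
  have der: "(D has_real_derivative d t) (at t)" if t: "0 < t" "t < 1" for t
  proof -
    have "k * t \<le> t" using k t by (simp add: mult_le_cancel_right1)
    moreover have "k * t > 0" using k t by simp
    ultimately have kt: "\<bar>k * t\<bar> < 1" using t by linarith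
    have "((\<lambda>t. renyi_fun \<beta> (k * t)) has_real_derivative renyi_slope m (k * t) * k) (at t)"
      unfolding m_def
      by (rule DERIV_chain2[where f = "renyi_fun \<beta>" and g = "\<lambda>t. k * t" and x = t, OF DERIV_renyi_fun[OF kt \<beta>]])
        (auto intro!: derivative_eq_intros)
    moreover have "(renyi_fun \<beta> has_real_derivative renyi_slope m t) (at t)"
      using t \<beta> unfolding m_def by (intro DERIV_renyi_fun) auto
    ultimately have "(D has_real_derivative \<sigma> * (renyi_slope m (k * t) * k - r * renyi_slope m t)) (at t)"
      unfolding D_def by (intro DERIV_cmult DERIV_diff)
    moreover have "\<sigma> * (renyi_slope m (k * t) * k - r * renyi_slope m t) = d t"
      using renyi_slope_pos[OF t, of m] by (simp add: d_def r_def m_def field_simps)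
    ultimately show ?thesis by simp
  qed
  have cont: "continuous_on {0..1} D"
    unfolding D_def using k \<beta>
    by (intro continuous_intros continuous_on_compose2[OF continuous_on_renyi_fun]) (auto intro: mult_le_one order_trans[of "-1" 0])
  have "D c \<le> D \<gamma>"
  proof (cases "c \<le> \<gamma>")
    case True
    show ?thesis
    proof (rule DERIV_nonneg_imp_increasing_open[OF True])
      fix t assume t: "c < t" "t < \<gamma>"
      then have "d t \<ge> 0"
        using renyi_slope_ratio_antimono[OF \<sigma>' k, of t \<gamma>] renyi_slope_pos[of t m] c k \<gamma>
        unfolding d_def by (intro mult_nonneg_nonneg) auto
      then show "\<exists>d. (D has_real_derivative d) (at t) \<and> d \<ge> 0" using der[of t] t c \<gamma> by auto
    qed (use c \<gamma> in \<open>auto intro: continuous_on_subset[OF cont]\<close>)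
  next
    case False
    then have "\<gamma> \<le> c" by simp
    then show ?thesis
    proof (rule DERIV_nonpos_imp_decreasing_open)
      fix t assume t: "\<gamma> < t" "t < c"
      then have "d t \<le> 0"
        using renyi_slope_ratio_antimono[OF \<sigma>' k, of \<gamma> t] renyi_slope_pos[of t m] c k \<gamma>
        unfolding d_def by (intro mult_nonneg_nonpos) auto
      then show "\<exists>d. (D has_real_derivative d) (at t) \<and> d \<le> 0" using der[of t] t c \<gamma> by auto
    qed (use c \<gamma> in \<open>auto intro: continuous_on_subset[OF cont]\<close>)
  qed
  then show ?thesis by (simp add: D_def algebra_simps)
qed

text \<open>The gaps \<sigma> M - \<sigma> f i are nonnegative with weighted sum 0, so every
  weighted gap vanishes. It serves means at the minimum (\<sigma> = -1) or maximum (\<sigma> = 1) of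
  \<open>renyi_fun\<close>.\<close>

lemma mean_eq_extremum_imp_const:
  fixes f w :: "'i \<Rightarrow> real" and \<sigma> :: real
  assumes "finite A" "\<And>i. i \<in> A \<Longrightarrow> w i \<ge> 0" "sum w A = 1"
    and "\<And>i. i \<in> A \<Longrightarrow> \<sigma> * f i \<le> \<sigma> * M" and "(\<Sum>i\<in>A. w i * f i) = M" and "\<sigma> \<noteq> 0" "i \<in> A"
  shows "w i = 0 \<or> f i = M"
proof -
  have "(\<Sum>i\<in>A. w i * (\<sigma> * M - \<sigma> * f i)) = \<sigma> * (M * sum w A - (\<Sum>i\<in>A. w i * f i))"
    by (simp add: sum_distrib_left sum_subtractf algebra_simps)
  then have "(\<Sum>i\<in>A. w i * (\<sigma> * M - \<sigma> * f i)) = 0" using assms by simp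
  then have "\<forall>i\<in>A. w i * (\<sigma> * M - \<sigma> * f i) = 0"
    using assms by (subst (asm) sum_nonneg_eq_0_iff) auto
  then show ?thesis using assms by auto
qed

text \<open>The supporting line at \<gamma> is averaged over i; its linear term vanishes because
  F(\<gamma>) is the mean of the F(c i).\<close>

lemma renyi_fun_jensen:
  fixes \<sigma> \<beta> k \<gamma> :: real and c w :: "'i \<Rightarrow> real"
  assumes \<sigma>: "\<sigma> * ((2 - \<beta>) * (3 - \<beta>)) \<ge> 0" and \<beta>: "\<beta> > 0"
    and A: "finite A" and w: "\<And>i. i \<in> A \<Longrightarrow> w i \<ge> 0" and w1: "sum w A = 1"
    and c: "\<And>i. i \<in> A \<Longrightarrow> c i \<in> {0..1}" and \<gamma>: "\<gamma> \<in> {0..1}" and k: "k \<in> {0..1}"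
    and mean: "(\<Sum>i\<in>A. w i * renyi_fun \<beta> (c i)) = renyi_fun \<beta> \<gamma>"
  shows "\<sigma> * (\<Sum>i\<in>A. w i * renyi_fun \<beta> (k * c i)) \<le> \<sigma> * renyi_fun \<beta> (k * \<gamma>)"
proof -
  have const: ?thesis if "\<And>i. i \<in> A \<Longrightarrow> w i = 0 \<or> k * c i = k * \<gamma>"
  proof -
    have "(\<Sum>i\<in>A. w i * renyi_fun \<beta> (k * c i)) = (\<Sum>i\<in>A. w i * renyi_fun \<beta> (k * \<gamma>))"
      using that by (intro sum.cong) fastforce+
    then show ?thesis using w1 by (simp flip: sum_distrib_right)
  qed
  \<comment> \<open>\<open>renyi_fun_support\<close> requires k > 0 and \<gamma> strictly between 0
    and 1. In the other cases k c i = k \<gamma> wherever the weight is nonzero, so both sides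
    agree.\<close>
  consider "k = 0" | "\<gamma> = 0" | "\<gamma> = 1" | "0 < k" "0 < \<gamma>" "\<gamma> < 1" using k \<gamma> by fastforce
  then show ?thesis
  proof cases
    case 1
    then show ?thesis by (intro const) simp
  next
    case 2
    show ?thesis
    proof (rule const)
      fix i assume i: "i \<in> A"
      have "w i = 0 \<or> renyi_fun \<beta> (c i) = renyi_fun \<beta> \<gamma>"
        by (rule mean_eq_extremum_imp_const[OF A w w1 _ mean _ i, of "-1"])
          (use 2 \<beta> c in \<open>auto simp: renyi_fun_le_iff\<close>)
      then show "w i = 0 \<or> k * c i = k * \<gamma>" using c[OF i] \<gamma> \<beta> by (auto simp: renyi_fun_eq_iff)
    qed
  next
    case 3
    show ?thesis
    proof (rule const)
      fix i assume i: "i \<in> A"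
      have "w i = 0 \<or> renyi_fun \<beta> (c i) = renyi_fun \<beta> \<gamma>"
        by (rule mean_eq_extremum_imp_const[OF A w w1 _ mean _ i, of 1])
          (use 3 \<beta> c in \<open>auto simp: renyi_fun_le_iff\<close>)
      then show "w i = 0 \<or> k * c i = k * \<gamma>" using c[OF i] \<gamma> \<beta> by (auto simp: renyi_fun_eq_iff)
    qed
  next
    case 4
    define r where "r = k * (renyi_slope (\<beta> - 1) (k * \<gamma>) / renyi_slope (\<beta> - 1) \<gamma>)"
    have "(\<Sum>i\<in>A. w i * (\<sigma> * (renyi_fun \<beta> (k * c i) - renyi_fun \<beta> (k * \<gamma>))))
        \<le> (\<Sum>i\<in>A. w i * (\<sigma> * (r * (renyi_fun \<beta> (c i) - renyi_fun \<beta> \<gamma>))))"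
      unfolding r_def using 4 k c w
      by (intro sum_mono mult_left_mono renyi_fun_support[OF \<sigma> \<beta>]) auto
    also have "\<dots> = \<sigma> * r * ((\<Sum>i\<in>A. w i * renyi_fun \<beta> (c i)) - renyi_fun \<beta> \<gamma> * sum w A)"
      by (simp add: sum_distrib_left sum_distrib_right sum_subtractf algebra_simps)
    also have "\<dots> = 0" using mean w1 by simp
    also have "(\<Sum>i\<in>A. w i * (\<sigma> * (renyi_fun \<beta> (k * c i) - renyi_fun \<beta> (k * \<gamma>))))
       = \<sigma> * (\<Sum>i\<in>A. w i * renyi_fun \<beta> (k * c i)) - \<sigma> * renyi_fun \<beta> (k * \<gamma>) * sum w A"
      by (simp add: sum_distrib_left sum_distrib_right sum_subtractf algebra_simps)
    finally show ?thesis using w1 by simp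
  qed
qed

text \<open>One variable is averaged while the other acts as the scale k: first d with scale c i,
  then c with scale \<delta>.\<close>

lemma renyi_fun_jensen2:
  fixes \<sigma> \<beta> \<gamma> \<delta> :: real and c w :: "'i \<Rightarrow> real" and d v :: "'j \<Rightarrow> real"
  assumes \<sigma>: "\<sigma> * ((2 - \<beta>) * (3 - \<beta>)) \<ge> 0" and \<beta>: "\<beta> > 0"
    and A: "finite A" "\<And>i. i \<in> A \<Longrightarrow> w i \<ge> 0" "sum w A = 1" "\<And>i. i \<in> A \<Longrightarrow> c i \<in> {0..1}"
    and B: "finite B" "\<And>j. j \<in> B \<Longrightarrow> v j \<ge> 0" "sum v B = 1" "\<And>j. j \<in> B \<Longrightarrow> d j \<in> {0..1}"
    and \<gamma>: "\<gamma> \<in> {0..1}" "(\<Sum>i\<in>A. w i * renyi_fun \<beta> (c i)) = renyi_fun \<beta> \<gamma>"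
    and \<delta>: "\<delta> \<in> {0..1}" "(\<Sum>j\<in>B. v j * renyi_fun \<beta> (d j)) = renyi_fun \<beta> \<delta>"
  shows "\<sigma> * (\<Sum>i\<in>A. \<Sum>j\<in>B. w i * v j * renyi_fun \<beta> (c i * d j)) \<le> \<sigma> * renyi_fun \<beta> (\<gamma> * \<delta>)"
proof -
  have "\<sigma> * (\<Sum>i\<in>A. \<Sum>j\<in>B. w i * v j * renyi_fun \<beta> (c i * d j))
      = (\<Sum>i\<in>A. w i * (\<sigma> * (\<Sum>j\<in>B. v j * renyi_fun \<beta> (c i * d j))))"
    by (simp add: sum_distrib_left algebra_simps)
  also have "\<dots> \<le> (\<Sum>i\<in>A. w i * (\<sigma> * renyi_fun \<beta> (c i * \<delta>)))"
    using A by (intro sum_mono mult_left_mono renyi_fun_jensen[OF \<sigma> \<beta> B(1,2,3,4) \<delta>(1) _ \<delta>(2)]) auto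
  also have "\<dots> = \<sigma> * (\<Sum>i\<in>A. w i * renyi_fun \<beta> (\<delta> * c i))"
    by (simp add: sum_distrib_left algebra_simps)
  also have "\<dots> \<le> \<sigma> * renyi_fun \<beta> (\<delta> * \<gamma>)"
    by (rule renyi_fun_jensen[OF \<sigma> \<beta> A \<gamma>(1) \<delta>(1) \<gamma>(2)])
  finally show ?thesis by (simp add: mult.commute)
qed

text \<open>The intermediate value theorem replaces a whole family of biases by one effective bias
  \<gamma>; signs disappear because \<open>renyi_fun\<close> is even.\<close>

lemma renyi_fun_mean:
  fixes c w :: "'i \<Rightarrow> real"
  assumes \<beta>: "\<beta> > 0" and A: "finite A" "\<And>i. i \<in> A \<Longrightarrow> w i \<ge> 0" "sum w A = 1"
    and c: "\<And>i. i \<in> A \<Longrightarrow> \<bar>c i\<bar> \<le> 1"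
  obtains \<gamma> where "\<gamma> \<in> {0..1}" "(\<Sum>i\<in>A. w i * renyi_fun \<beta> (c i)) = renyi_fun \<beta> \<gamma>"
proof -
  have bounds: "renyi_fun \<beta> 0 \<le> renyi_fun \<beta> (c i)" "renyi_fun \<beta> (c i) \<le> renyi_fun \<beta> 1" if "i \<in> A" for i
    using renyi_fun_le_iff[OF \<beta>, of 0 "\<bar>c i\<bar>"] renyi_fun_le_iff[OF \<beta>, of "\<bar>c i\<bar>" 1] c[OF that] by auto
  have "(\<Sum>i\<in>A. w i * renyi_fun \<beta> (c i)) \<ge> (\<Sum>i\<in>A. w i * renyi_fun \<beta> 0)"
    using A bounds by (intro sum_mono mult_left_mono) auto
  moreover have "(\<Sum>i\<in>A. w i * renyi_fun \<beta> (c i)) \<le> (\<Sum>i\<in>A. w i * renyi_fun \<beta> 1)"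
    using A bounds by (intro sum_mono mult_left_mono) auto
  moreover have "continuous_on {0..1} (renyi_fun \<beta>)"
    by (rule continuous_on_subset[OF continuous_on_renyi_fun[OF \<beta>]]) auto
  ultimately show thesis
    using IVT'[of "renyi_fun \<beta>" 0 "\<Sum>i\<in>A. w i * renyi_fun \<beta> (c i)" 1] A that
    by (auto simp flip: sum_distrib_right)
qed

section \<open>Binary entropies as functions of the bias\<close>

text \<open>This converts a mean of \<open>renyi_fun \<beta>\<close> into an entropy. At a single
  value \<open>renyi_fun \<beta> c\<close> it is the binary entropy of (1 - c) / 2, by
  \<open>binary_renyi_eq_level\<close>.\<close>

definition renyi_level :: "real \<Rightarrow> real \<Rightarrow> real" where
  "renyi_level \<beta> z = (if \<beta> = 1 then ln 2 - z / 2 else ln (\<beta> * (\<beta> - 1) * z / 2 powr \<beta>) / (1 - \<beta>))"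

lemma x_ln_x_mult:
  fixes x y :: real
  assumes "x \<ge> 0" "y \<ge> 0"
  shows "(x * y) * ln (x * y) = x * (y * ln y) + y * (x * ln x)"
  using assms by (cases "x = 0 \<or> y = 0") (auto simp: ln_mult algebra_simps)

text \<open>The Shannon counterpart of \<open>renyi_fun_split\<close>: a mass T is divided in the
  proportions (1 + c) / 2 and (1 - c) / 2, and the product rule for x ln x separates T from
  c.\<close>

lemma x_ln_x_split:
  fixes T c :: real
  assumes "T \<ge> 0" "\<bar>c\<bar> \<le> 1"
  defines "L \<equiv> (\<lambda>x::real. x * ln x)"
  shows "L (T * ((1 + c) / 2)) + L (T * ((1 - c) / 2)) = T / 2 * renyi_fun 1 c + L T - T * ln 2"
proof -
  have mult: "L (T * x) = T * L x + x * L T" if "x \<ge> 0" for x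
    unfolding L_def using x_ln_x_mult[OF \<open>T \<ge> 0\<close> that] .
  have half: "L (x / 2) = L x / 2 - x * (ln 2 / 2)" if "x \<ge> 0" for x
    unfolding L_def using x_ln_x_mult[OF that, of "1 / 2"] by (simp add: ln_div algebra_simps)
  have pos: "1 + c \<ge> 0" "1 - c \<ge> 0" using assms by auto
  have split: "L (T * (x / 2)) = T * (L x / 2 - x * (ln 2 / 2)) + x / 2 * L T" if "x \<ge> 0" for x
    using mult[of "x / 2"] half[OF that] that by (simp only: divide_nonneg_pos zero_less_numeral)
  have "renyi_fun 1 c = L (1 + c) + L (1 - c)" by (simp add: renyi_fun_def L_def)
  then show ?thesis
    using split[OF pos(1)] split[OF pos(2)] by (simp only:) (simp add: field_simps)
qed

text \<open>Powers are multiplicative, so the total T separates from the bias c; the factor \<beta>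
  (\<beta> - 1) undoes the normalisation of \<open>renyi_fun\<close>.\<close>

lemma renyi_fun_split:
  fixes T c \<beta> :: real
  assumes "T \<ge> 0" "\<bar>c\<bar> \<le> 1" "\<beta> > 0" "\<beta> \<noteq> 1"
  shows "(T * ((1 + c) / 2)) powr \<beta> + (T * ((1 - c) / 2)) powr \<beta>
       = T powr \<beta> * (\<beta> * (\<beta> - 1) * renyi_fun \<beta> c / 2 powr \<beta>)"
proof -
  have "(T * ((1 + c) / 2)) powr \<beta> = T powr \<beta> * ((1 + c) powr \<beta> / 2 powr \<beta>)"
    "(T * ((1 - c) / 2)) powr \<beta> = T powr \<beta> * ((1 - c) powr \<beta> / 2 powr \<beta>)"
    using assms by (simp_all add: powr_mult powr_divide)
  then show ?thesis using assms by (simp add: renyi_fun_def add_divide_distrib distrib_left)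
qed

lemma binary_renyi_eq_level:
  assumes "\<beta> > 0" "\<bar>c\<bar> \<le> 1"
  shows "binary_renyi \<beta> ((1 - c) / 2) = renyi_level \<beta> (renyi_fun \<beta> c)"
proof -
  have t: "1 - (1 - c) / 2 = (1 + c) / 2" by (simp add: field_simps)
  show ?thesis
  proof (cases "\<beta> = 1")
    case True
    then show ?thesis using x_ln_x_split[of 1 c] assms unfolding binary_renyi_def t
      by (simp add: renyi_level_def)
  next
    case False
    then show ?thesis using renyi_fun_split[of 1 c \<beta>] assms unfolding binary_renyi_def t
      by (simp add: renyi_level_def add.commute)
  qed
qed

lemma renyi_fun_scaled_pos:
  assumes "\<beta> > 0" "\<beta> \<noteq> 1" "\<bar>c\<bar> \<le> 1"
  shows "\<beta> * (\<beta> - 1) * renyi_fun \<beta> c > 0"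
proof -
  have "\<beta> * (\<beta> - 1) * renyi_fun \<beta> c = (1 + c) powr \<beta> + (1 - c) powr \<beta>"
    using assms by (simp add: renyi_fun_def)
  moreover have "\<dots> > 0"
    using assms by (cases "c = 1") (auto intro!: add_nonneg_pos)
  ultimately show ?thesis by simp
qed

text \<open>For \<beta> > 1 the factor \<beta> (\<beta> - 1) keeps the order and the division by 1 -
  \<beta> reverses it; for \<beta> < 1 the roles are exchanged. Either way there is exactly one
  reversal.\<close>

lemma renyi_level_strict_antimono:
  assumes \<beta>: "\<beta> > 0" and x: "0 \<le> x" "x < y" "y \<le> 1"
  shows "renyi_level \<beta> (renyi_fun \<beta> y) < renyi_level \<beta> (renyi_fun \<beta> x)"
proof -
  have lt: "renyi_fun \<beta> x < renyi_fun \<beta> y" using assms by (intro renyi_fun_strict_mono) auto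
  consider "\<beta> = 1" | "\<beta> > 1" | "\<beta> < 1" by linarith
  then show ?thesis
  proof cases
    case 1
    then show ?thesis using lt by (simp add: renyi_level_def)
  next
    case 2
    then have "ln (\<beta> * (\<beta> - 1) * renyi_fun \<beta> x / 2 powr \<beta>) < ln (\<beta> * (\<beta> - 1) * renyi_fun \<beta> y / 2 powr \<beta>)"
      using lt renyi_fun_scaled_pos[of \<beta> x] renyi_fun_scaled_pos[of \<beta> y] assms
      by (subst ln_less_cancel_iff) (auto intro!: divide_strict_right_mono)
    then show ?thesis using 2 by (simp add: renyi_level_def divide_strict_right_mono_neg)
  next
    case 3
    then have "ln (\<beta> * (\<beta> - 1) * renyi_fun \<beta> y / 2 powr \<beta>) < ln (\<beta> * (\<beta> - 1) * renyi_fun \<beta> x / 2 powr \<beta>)"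
      using lt renyi_fun_scaled_pos[of \<beta> x] renyi_fun_scaled_pos[of \<beta> y] assms
      by (subst ln_less_cancel_iff) (auto intro!: divide_strict_right_mono mult_strict_left_mono_neg mult_pos_neg)
    then show ?thesis using 3 by (simp add: renyi_level_def divide_strict_right_mono)
  qed
qed

lemma renyi_level_le_iff:
  assumes "\<beta> > 0" "x \<in> {0..1}" "y \<in> {0..1}"
  shows "renyi_level \<beta> (renyi_fun \<beta> x) \<le> renyi_level \<beta> (renyi_fun \<beta> y) \<longleftrightarrow> renyi_fun \<beta> y \<le> renyi_fun \<beta> x"
  using renyi_level_strict_antimono[of \<beta> x y] renyi_level_strict_antimono[of \<beta> y x] assms
  by (cases x y rule: linorder_cases) (auto simp: renyi_fun_le_iff)

text \<open>In the coordinate \<gamma> = 1 - 2 t the binary entropy is strictly decreasing on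
  [0, 1], hence injective in t on [0, 1/2], and the inverse can be read off.\<close>

lemma binary_renyi_inv_level:
  assumes \<beta>: "\<beta> > 0" and \<gamma>: "\<gamma> \<in> {0..1}"
  shows "binary_renyi_inv \<beta> (renyi_level \<beta> (renyi_fun \<beta> \<gamma>)) = (1 - \<gamma>) / 2"
proof -
  have "inj_on (binary_renyi \<beta>) {0..1/2}"
  proof (rule inj_onI)
    fix s t :: real
    assume st: "s \<in> {0..1/2}" "t \<in> {0..1/2}" "binary_renyi \<beta> s = binary_renyi \<beta> t"
    have "renyi_level \<beta> (renyi_fun \<beta> (1 - 2 * s)) = renyi_level \<beta> (renyi_fun \<beta> (1 - 2 * t))"
      using st binary_renyi_eq_level[OF \<beta>, of "1 - 2 * s"] binary_renyi_eq_level[OF \<beta>, of "1 - 2 * t"] by simp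
    then have "1 - 2 * s = 1 - 2 * t"
      using st renyi_level_strict_antimono[OF \<beta>, of "1 - 2 * s" "1 - 2 * t"]
        renyi_level_strict_antimono[OF \<beta>, of "1 - 2 * t" "1 - 2 * s"]
      by (cases "1 - 2 * s" "1 - 2 * t" rule: linorder_cases) auto
    then show "s = t" by simp
  qed
  moreover have "renyi_level \<beta> (renyi_fun \<beta> \<gamma>) = binary_renyi \<beta> ((1 - \<gamma>) / 2)"
    using \<beta> \<gamma> by (simp add: binary_renyi_eq_level)
  ultimately show ?thesis
    unfolding binary_renyi_inv_def using \<gamma> by (intro the_inv_into_f_eq) auto
qed

text \<open>Biases multiply under binary convolution: 1 - 2 (a \<star> b) = (1 - 2 a) (1 - 2
  b).\<close>

lemma binary_renyi_conv_level:
  assumes "\<beta> > 0" "\<gamma> \<in> {0..1}" "\<delta> \<in> {0..1}"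
  shows "binary_renyi \<beta> (binary_renyi_inv \<beta> (renyi_level \<beta> (renyi_fun \<beta> \<gamma>))
                       \<star> binary_renyi_inv \<beta> (renyi_level \<beta> (renyi_fun \<beta> \<delta>)))
       = renyi_level \<beta> (renyi_fun \<beta> (\<gamma> * \<delta>))"
proof -
  have "((1 - \<gamma>) / 2) \<star> ((1 - \<delta>) / 2) = (1 - \<gamma> * \<delta>) / 2"
    by (simp add: binary_conv_def field_simps)
  moreover have "\<bar>\<gamma> * \<delta>\<bar> \<le> 1" using assms by (auto simp: abs_mult mult_le_one)
  ultimately show ?thesis
    unfolding binary_renyi_inv_level[OF assms(1,2)] binary_renyi_inv_level[OF assms(1,3)]
    using binary_renyi_eq_level[OF assms(1)] by (simp only:)
qed

section \<open>Entropies in terms of biases\<close>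

lemma sum_UNIV_bit: "(\<Sum>x\<in>UNIV. f x) = f 0 + f (1::bit)"
proof -
  have "(UNIV :: bit set) = {0, 1}" using bit_not_zero_iff by blast
  moreover have "sum f {0, 1} = f 0 + f 1" by simp
  ultimately show ?thesis by (simp only:)
qed

lemma sum_UNIV_bit_prod:
  fixes f :: "bit \<times> 'b::finite \<times> 'c::finite \<Rightarrow> real"
  shows "(\<Sum>z\<in>UNIV. f z) = (\<Sum>y1\<in>UNIV. \<Sum>y2\<in>UNIV. f (0, y1, y2) + f (1, y1, y2))"
proof -
  have "(\<Sum>z\<in>UNIV. f z) = (\<Sum>s\<in>UNIV. \<Sum>y1\<in>UNIV. \<Sum>y2\<in>UNIV. f (s, y1, y2))"
    by (simp add: sum.cartesian_product UNIV_Times_UNIV)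
  then show ?thesis by (simp add: sum_UNIV_bit sum.distrib)
qed

lemma pmf_sum_law:
  "pmf (sum_law p1 p2) (x, (s, y1, y2)) = pmf p1 (s + x, y1) * pmf p2 (x, y2)"
proof -
  define f where "f = (\<lambda>((x1::bit, y1::'a), (x2::bit, y2::'b)). (x2, (x1 + x2, y1, y2)))"
  have "inj f" by (auto simp: inj_def f_def)
  \<comment> \<open>Modulo 2, s + x + x = s, so the first bit is the sum plus the second
    bit.\<close>
  moreover have "f ((s + x, y1), (x, y2)) = (x, (s, y1, y2))"
    by (cases x) (auto simp: f_def add.assoc)
  ultimately have "pmf (map_pmf f (pair_pmf p1 p2)) (x, (s, y1, y2)) = pmf (pair_pmf p1 p2) ((s + x, y1), (x, y2))"
    using pmf_map_inj' by metis
  then show ?thesis by (simp add: sum_law_def f_def pmf_pair)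
qed

section \<open>Entropies from joint probabilities\<close>

text \<open>The factor p(y) is moved inside the outer power as p(y)^\<alpha>, turning conditional
  into joint probabilities. Values y of probability 0 can be restored since they contribute
  0.\<close>

lemma arimoto_entropy_joint:
  fixes p :: "('x::finite \<times> 'y::finite) pmf"
  assumes \<alpha>: "\<alpha> > 0" "\<alpha> \<noteq> 1"
  shows "arimoto_entropy \<alpha> p = - ln (\<Sum>y\<in>UNIV. (\<Sum>x\<in>UNIV. pmf p (x, y) powr \<alpha>) powr (1 / \<alpha>)) / (1 - 1 / \<alpha>)"
proof -
  have "(\<Sum>y | marginal_snd p y > 0. marginal_snd p y * (\<Sum>x\<in>UNIV. cond_prob p x y powr \<alpha>) powr (1 / \<alpha>))
      = (\<Sum>y | marginal_snd p y > 0. (\<Sum>x\<in>UNIV. pmf p (x, y) powr \<alpha>) powr (1 / \<alpha>))"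
  proof (rule sum.cong)
    fix y assume "y \<in> {y. marginal_snd p y > 0}"
    then have y: "marginal_snd p y > 0" by simp
    have "(\<Sum>x\<in>UNIV. pmf p (x, y) powr \<alpha>) = marginal_snd p y powr \<alpha> * (\<Sum>x\<in>UNIV. cond_prob p x y powr \<alpha>)"
      using y by (simp add: cond_prob_def powr_divide flip: sum_divide_distrib)
    then show "marginal_snd p y * (\<Sum>x\<in>UNIV. cond_prob p x y powr \<alpha>) powr (1 / \<alpha>)
             = (\<Sum>x\<in>UNIV. pmf p (x, y) powr \<alpha>) powr (1 / \<alpha>)"
      using y \<alpha> by (simp add: powr_mult powr_powr sum_nonneg)
  qed simp
  also have "\<dots> = (\<Sum>y\<in>UNIV. (\<Sum>x\<in>UNIV. pmf p (x, y) powr \<alpha>) powr (1 / \<alpha>))"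
  proof (rule sum.mono_neutral_left)
    show "\<forall>y\<in>UNIV - {y. marginal_snd p y > 0}. (\<Sum>x\<in>UNIV. pmf p (x, y) powr \<alpha>) powr (1 / \<alpha>) = 0"
    proof
      fix y assume "y \<in> UNIV - {y. marginal_snd p y > 0}"
      then have "(\<Sum>x\<in>UNIV. pmf p (x, y)) = 0"
        by (simp add: marginal_snd_eq_sum not_less order_antisym sum_nonneg)
      then show "(\<Sum>x\<in>UNIV. pmf p (x, y) powr \<alpha>) powr (1 / \<alpha>) = 0"
        by (simp add: sum_nonneg_eq_0_iff)
    qed
  qed auto
  finally show ?thesis using \<alpha> by (simp add: arimoto_entropy_def field_simps)
qed

text \<open>The chain rule H(X|Y) = H(X,Y) - H(Y), obtained by expanding x ln x at p(y)
  p(x|y).\<close>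

lemma arimoto_entropy_1_joint:
  fixes p :: "('x::finite \<times> 'y::finite) pmf"
  shows "arimoto_entropy 1 p = (\<Sum>y\<in>UNIV. marginal_snd p y * ln (marginal_snd p y)
                                   - (\<Sum>x\<in>UNIV. pmf p (x, y) * ln (pmf p (x, y))))"
proof -
  have "arimoto_entropy 1 p = (\<Sum>y | marginal_snd p y > 0. - (marginal_snd p y *
               (\<Sum>x\<in>UNIV. cond_prob p x y * ln (cond_prob p x y))))"
    by (simp add: arimoto_entropy_def sum_negf)
  also have "\<dots> = (\<Sum>y | marginal_snd p y > 0. marginal_snd p y * ln (marginal_snd p y)
                                   - (\<Sum>x\<in>UNIV. pmf p (x, y) * ln (pmf p (x, y))))"
  proof (rule sum.cong)
    fix y assume "y \<in> {y. marginal_snd p y > 0}"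
    then have y: "marginal_snd p y > 0" by simp
    have "(\<Sum>x\<in>UNIV. pmf p (x, y) * ln (pmf p (x, y)))
        = (\<Sum>x\<in>UNIV. marginal_snd p y * (cond_prob p x y * ln (cond_prob p x y))
              + cond_prob p x y * (marginal_snd p y * ln (marginal_snd p y)))"
    proof (rule sum.cong)
      fix x
      have "pmf p (x, y) = marginal_snd p y * cond_prob p x y" "cond_prob p x y \<ge> 0"
        using y by (auto simp: cond_prob_def)
      then show "pmf p (x, y) * ln (pmf p (x, y)) = marginal_snd p y * (cond_prob p x y * ln (cond_prob p x y))
              + cond_prob p x y * (marginal_snd p y * ln (marginal_snd p y))"
        using y x_ln_x_mult[of "marginal_snd p y" "cond_prob p x y"] by simp
    qed simp
    also have "\<dots> = marginal_snd p y * (\<Sum>x\<in>UNIV. cond_prob p x y * ln (cond_prob p x y))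
                     + marginal_snd p y * ln (marginal_snd p y)"
      using sum_cond_prob[OF y] by (simp add: sum.distrib flip: sum_distrib_left sum_distrib_right)
    finally show "- (marginal_snd p y * (\<Sum>x\<in>UNIV. cond_prob p x y * ln (cond_prob p x y)))
       = marginal_snd p y * ln (marginal_snd p y) - (\<Sum>x\<in>UNIV. pmf p (x, y) * ln (pmf p (x, y)))" by simp
  qed simp
  also have "\<dots> = (\<Sum>y\<in>UNIV. marginal_snd p y * ln (marginal_snd p y)
                                   - (\<Sum>x\<in>UNIV. pmf p (x, y) * ln (pmf p (x, y))))"
  proof (rule sum.mono_neutral_left)
    show "\<forall>y\<in>UNIV - {y. marginal_snd p y > 0}. marginal_snd p y * ln (marginal_snd p y)
                                   - (\<Sum>x\<in>UNIV. pmf p (x, y) * ln (pmf p (x, y))) = 0"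
    proof
      fix y assume "y \<in> UNIV - {y. marginal_snd p y > 0}"
      then have "(\<Sum>x\<in>UNIV. pmf p (x, y)) = 0"
        by (simp add: marginal_snd_eq_sum not_less order_antisym sum_nonneg)
      then show "marginal_snd p y * ln (marginal_snd p y)
                                   - (\<Sum>x\<in>UNIV. pmf p (x, y) * ln (pmf p (x, y))) = 0"
        by (simp add: sum_nonneg_eq_0_iff marginal_snd_eq_sum)
    qed
  qed auto
  finally show ?thesis .
qed

section \<open>Tilted weights and biases\<close>

definition tilt_total :: "real \<Rightarrow> (bit \<times> 'y) pmf \<Rightarrow> 'y \<Rightarrow> real" where
  "tilt_total \<alpha> p y = pmf p (0, y) powr \<alpha> + pmf p (1, y) powr \<alpha>"

text \<open>
  If \<^term>\<open>tilt_total \<alpha> p y\<close> vanishes the bias is \<open>0\<close>, and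
  so is the weight.
\<close>

definition tilt_bias :: "real \<Rightarrow> (bit \<times> 'y) pmf \<Rightarrow> 'y \<Rightarrow> real" where
  "tilt_bias \<alpha> p y = (pmf p (0, y) powr \<alpha> - pmf p (1, y) powr \<alpha>) / tilt_total \<alpha> p y"

text \<open>Before normalisation this is the summand p(y) (sum_x p(x|y)^\<alpha>)^(1/\<alpha>) of
  the entropy; at \<alpha> = 1 it is the marginal, see \<open>tilt_1\<close>.\<close>

definition tilt_weight :: "real \<Rightarrow> (bit \<times> 'y::finite) pmf \<Rightarrow> 'y \<Rightarrow> real" where
  "tilt_weight \<alpha> p y = tilt_total \<alpha> p y powr (1 / \<alpha>) / (\<Sum>z\<in>UNIV. tilt_total \<alpha> p z powr (1 / \<alpha>))"

lemma tilt_total_nonneg: "tilt_total \<alpha> p y \<ge> 0"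
  by (simp add: tilt_total_def)

lemma tilt_total_eq_0_iff: "tilt_total \<alpha> p y = 0 \<longleftrightarrow> pmf p (0, y) = 0 \<and> pmf p (1, y) = 0"
  by (auto simp: tilt_total_def add_nonneg_eq_0_iff)

lemma abs_tilt_bias_le_1: "\<bar>tilt_bias \<alpha> p y\<bar> \<le> 1"
proof -
  have "\<bar>pmf p (0, y) powr \<alpha> - pmf p (1, y) powr \<alpha>\<bar> \<le> \<bar>tilt_total \<alpha> p y\<bar>"
    by (simp add: tilt_total_def abs_le_iff)
  then show ?thesis by (cases "tilt_total \<alpha> p y = 0") (simp_all add: tilt_bias_def)
qed

text \<open>Total and bias determine both tilted probabilities, in the shape that
  \<open>renyi_fun_split\<close> and \<open>x_ln_x_split\<close> expect. If the total is 0, both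
  sides are 0.\<close>

lemma tilt_total_bias:
  "tilt_total \<alpha> p y * ((1 + tilt_bias \<alpha> p y) / 2) = pmf p (0, y) powr \<alpha>"
  "tilt_total \<alpha> p y * ((1 - tilt_bias \<alpha> p y) / 2) = pmf p (1, y) powr \<alpha>"
  using tilt_total_eq_0_iff[of \<alpha> p y]
  by (cases "tilt_total \<alpha> p y = 0"; simp add: tilt_bias_def; simp add: tilt_total_def field_simps)+

lemma sum_tilt_total_pos:
  fixes p :: "(bit \<times> 'y::finite) pmf"
  shows "(\<Sum>y\<in>UNIV. tilt_total \<alpha> p y powr b) > 0"
proof -
  obtain x y where "(x, y) \<in> set_pmf p" using set_pmf_not_empty[of p] by fastforce
  then have "tilt_total \<alpha> p y \<noteq> 0"
    by (cases x) (auto simp: tilt_total_eq_0_iff set_pmf_iff)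
  then show ?thesis by (intro sum_pos2[of _ y]) auto
qed

lemma tilt_weight_nonneg: "tilt_weight \<alpha> p y \<ge> 0"
  by (simp add: tilt_weight_def sum_nonneg)

lemma sum_tilt_weight: "(\<Sum>y\<in>UNIV. tilt_weight \<alpha> p y) = 1"
  using sum_tilt_total_pos[of \<alpha> p "1 / \<alpha>"] by (simp add: tilt_weight_def flip: sum_divide_distrib)

lemma arimoto_entropy_tilt:
  fixes p :: "(bit \<times> 'y::finite) pmf"
  assumes \<alpha>: "\<alpha> > 0" "\<alpha> \<noteq> 1"
  shows "arimoto_entropy \<alpha> p = - ln (\<Sum>y\<in>UNIV. tilt_total \<alpha> p y powr (1 / \<alpha>)) / (1 - 1 / \<alpha>)"
  using assms by (simp add: arimoto_entropy_joint sum_UNIV_bit tilt_total_def)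

lemma tilt_1:
  fixes p :: "(bit \<times> 'y::finite) pmf"
  shows "tilt_total 1 p y = marginal_snd p y" "tilt_weight 1 p y = marginal_snd p y"
proof -
  show *: "tilt_total 1 p y = marginal_snd p y" for y
    by (simp add: tilt_total_def marginal_snd_eq_sum sum_UNIV_bit)
  have "(\<Sum>y\<in>UNIV. marginal_snd p y) = 1"
    unfolding marginal_snd_def by (rule sum_pmf_eq_1) auto
  then show "tilt_weight 1 p y = marginal_snd p y"
    by (simp add: tilt_weight_def * marginal_snd_def)
qed

text \<open>Raising the tilted probabilities to the power \<beta> = 1/\<alpha> gives back p(0,y) and
  p(1,y), which add up to 1 over all y. For \<alpha> \<noteq> 1 the scaled mean of F is therefore 1
  / K, with K the sum inside the logarithm of the entropy; for \<alpha> = 1 the chain rule is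
  used.\<close>

lemma arimoto_entropy_eq_level:
  fixes p :: "(bit \<times> 'y::finite) pmf"
  assumes \<alpha>: "\<alpha> > 0"
  shows "arimoto_entropy \<alpha> p
       = renyi_level (1 / \<alpha>) (\<Sum>y\<in>UNIV. tilt_weight \<alpha> p y * renyi_fun (1 / \<alpha>) (tilt_bias \<alpha> p y))"
proof (cases "\<alpha> = 1")
  case True
  define T where "T = tilt_total 1 p"
  have "T y * ln (T y) - (\<Sum>x\<in>UNIV. pmf p (x, y) * ln (pmf p (x, y)))
        = T y * ln 2 - T y * renyi_fun 1 (tilt_bias 1 p y) / 2" for y
    using x_ln_x_split[OF tilt_total_nonneg abs_tilt_bias_le_1, of 1 p y 1 p y, unfolded tilt_total_bias]
    by (simp add: sum_UNIV_bit T_def)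
  then have "arimoto_entropy 1 p = (\<Sum>y\<in>UNIV. T y) * ln 2 - (\<Sum>y\<in>UNIV. T y * renyi_fun 1 (tilt_bias 1 p y)) / 2"
    unfolding arimoto_entropy_1_joint tilt_1(1)[symmetric] T_def[symmetric]
    by (simp add: sum_subtractf sum_divide_distrib sum_distrib_right)
  also have "(\<Sum>y\<in>UNIV. T y) = 1"
    using sum_tilt_weight[of 1 p] by (simp add: T_def tilt_1)
  finally show ?thesis using True by (simp add: renyi_level_def T_def tilt_1)
next
  case False
  define \<beta> where "\<beta> = 1 / \<alpha>"
  define K where "K = (\<Sum>y\<in>UNIV. tilt_total \<alpha> p y powr \<beta>)"
  have K: "K > 0" unfolding K_def by (rule sum_tilt_total_pos)
  have \<beta>: "\<beta> > 0" "\<beta> \<noteq> 1" using \<alpha> False by (auto simp: \<beta>_def)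
  have "tilt_weight \<alpha> p y * renyi_fun \<beta> (tilt_bias \<alpha> p y) * (\<beta> * (\<beta> - 1) / 2 powr \<beta>)
      = (pmf p (0, y) + pmf p (1, y)) / K" for y
  proof -
    have "pmf p (0, y) + pmf p (1, y) = (pmf p (0, y) powr \<alpha>) powr \<beta> + (pmf p (1, y) powr \<alpha>) powr \<beta>"
      using \<alpha> by (simp add: powr_powr \<beta>_def)
    also have "\<dots> = tilt_total \<alpha> p y powr \<beta> * (\<beta> * (\<beta> - 1) * renyi_fun \<beta> (tilt_bias \<alpha> p y) / 2 powr \<beta>)"
      using renyi_fun_split[OF tilt_total_nonneg abs_tilt_bias_le_1 \<beta>, of \<alpha> p y \<alpha> p y, unfolded tilt_total_bias] .
    finally have uv: "pmf p (0, y) + pmf p (1, y) = \<dots>" .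
    have "tilt_weight \<alpha> p y = tilt_total \<alpha> p y powr \<beta> / K"
      by (simp add: tilt_weight_def K_def \<beta>_def)
    then show ?thesis unfolding uv by (simp add: mult_ac)
  qed
  then have "(\<Sum>y\<in>UNIV. tilt_weight \<alpha> p y * renyi_fun \<beta> (tilt_bias \<alpha> p y)) * (\<beta> * (\<beta> - 1) / 2 powr \<beta>)
      = (\<Sum>y\<in>UNIV. pmf p (0, y) + pmf p (1, y)) / K"
    by (simp add: sum_distrib_right sum_divide_distrib)
  also have "(\<Sum>y\<in>UNIV. pmf p (0, y) + pmf p (1, y)) = 1"
    using sum_tilt_weight[of 1 p] by (simp add: tilt_1 marginal_snd_eq_sum sum_UNIV_bit)
  finally have "\<beta> * (\<beta> - 1) * (\<Sum>y\<in>UNIV. tilt_weight \<alpha> p y * renyi_fun \<beta> (tilt_bias \<alpha> p y)) / 2 powr \<beta> = 1 / K"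
    by (simp add: mult_ac)
  then have "renyi_level \<beta> (\<Sum>y\<in>UNIV. tilt_weight \<alpha> p y * renyi_fun \<beta> (tilt_bias \<alpha> p y)) = ln (1 / K) / (1 - \<beta>)"
    using \<beta> by (simp only: renyi_level_def if_False)
  then show ?thesis
    using K \<alpha> False by (simp add: arimoto_entropy_tilt K_def \<beta>_def ln_div)
qed

text \<open>In terms of tilted probabilities, the sum 0 collects a1 a2 + b1 b2 and the sum 1
  collects b1 a2 + a1 b2: totals and biases both multiply.\<close>

lemma tilt_total_sum_law:
  fixes \<alpha> :: real and p1 :: "(bit \<times> 'b::finite) pmf" and p2 :: "(bit \<times> 'c::finite) pmf"
  defines "c \<equiv> \<lambda>y1 y2. tilt_bias \<alpha> p1 y1 * tilt_bias \<alpha> p2 y2"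
    and "T \<equiv> \<lambda>y1 y2. tilt_total \<alpha> p1 y1 * tilt_total \<alpha> p2 y2"
  shows "tilt_total \<alpha> (sum_law p1 p2) (0, y1, y2) = T y1 y2 * ((1 + c y1 y2) / 2)"
    and "tilt_total \<alpha> (sum_law p1 p2) (1, y1, y2) = T y1 y2 * ((1 - c y1 y2) / 2)"
  by (simp_all add: tilt_total_def[of _ "sum_law p1 p2"] pmf_sum_law powr_mult c_def T_def
        flip: tilt_total_bias) (simp_all add: field_simps)

text \<open>An exact identity, which leaves only the mean of F over products of biases to be
  estimated. For \<alpha> \<noteq> 1 the sum inside the logarithm factors as K1 K2 times the scaled
  mean; for \<alpha> = 1 the same separation comes from x ln x.\<close>

lemma arimoto_entropy_sum_law:
  fixes p1 :: "(bit \<times> 'b::finite) pmf" and p2 :: "(bit \<times> 'c::finite) pmf"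
  assumes \<alpha>: "\<alpha> > 0"
  shows "arimoto_entropy \<alpha> (sum_law p1 p2) = arimoto_entropy \<alpha> p1 + arimoto_entropy \<alpha> p2
    - renyi_level (1 / \<alpha>) (\<Sum>y1\<in>UNIV. \<Sum>y2\<in>UNIV. tilt_weight \<alpha> p1 y1 * tilt_weight \<alpha> p2 y2 *
          renyi_fun (1 / \<alpha>) (tilt_bias \<alpha> p1 y1 * tilt_bias \<alpha> p2 y2))"
proof -
  define c where "c = (\<lambda>y1 y2. tilt_bias \<alpha> p1 y1 * tilt_bias \<alpha> p2 y2)"
  define T1 where "T1 = tilt_total \<alpha> p1"
  define T2 where "T2 = tilt_total \<alpha> p2"
  have T: "T1 y1 \<ge> 0" "T2 y2 \<ge> 0" for y1 y2 by (auto simp: T1_def T2_def tilt_total_nonneg)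
  then have TT: "T1 y1 * T2 y2 \<ge> 0" for y1 y2 by simp
  have c: "\<bar>c y1 y2\<bar> \<le> 1" for y1 y2
    by (simp add: c_def abs_mult mult_le_one abs_tilt_bias_le_1)
  have tot: "tilt_total \<alpha> (sum_law p1 p2) (0, y1, y2) = T1 y1 * T2 y2 * ((1 + c y1 y2) / 2)"
    "tilt_total \<alpha> (sum_law p1 p2) (1, y1, y2) = T1 y1 * T2 y2 * ((1 - c y1 y2) / 2)" for y1 y2
    unfolding c_def T1_def T2_def by (rule tilt_total_sum_law)+
  show ?thesis
  proof (cases "\<alpha> = 1")
    case True
    define L where "L = (\<lambda>x::real. x * ln x)"
    define H1 where "H1 = (\<lambda>y. L (T1 y) - (\<Sum>x\<in>UNIV. L (pmf p1 (x, y))))"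
    define H2 where "H2 = (\<lambda>y. L (T2 y) - (\<Sum>x\<in>UNIV. L (pmf p2 (x, y))))"
    define H where "H = (\<lambda>y. L (tilt_total 1 (sum_law p1 p2) y) - (\<Sum>x\<in>UNIV. L (pmf (sum_law p1 p2) (x, y))))"
    have T1: "T1 y = pmf p1 (0, y) + pmf p1 (1, y)" for y
      by (simp add: T1_def tilt_total_def True)
    have T2: "T2 y = pmf p2 (0, y) + pmf p2 (1, y)" for y
      by (simp add: T2_def tilt_total_def True)
    have ent: "arimoto_entropy 1 p1 = (\<Sum>y\<in>UNIV. H1 y)" "arimoto_entropy 1 p2 = (\<Sum>y\<in>UNIV. H2 y)"
      "arimoto_entropy 1 (sum_law p1 p2) = (\<Sum>y\<in>UNIV. H y)"
      by (simp_all add: arimoto_entropy_1_joint H1_def H2_def H_def L_def T1_def T2_def True tilt_1)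
    have one: "(\<Sum>y\<in>UNIV. T1 y) = 1" "(\<Sum>y\<in>UNIV. T2 y) = 1"
      using sum_tilt_weight[of 1 p1] sum_tilt_weight[of 1 p2] by (simp_all add: T1_def T2_def True tilt_1)
    \<comment> \<open>The products of totals and of probabilities expand by L(x y) = x L y + y L x
      and regroup into \<open>H1\<close> and \<open>H2\<close>; the other terms come from
      \<open>x_ln_x_split\<close>.\<close>
    have "H (0, y1, y2) + H (1, y1, y2) = T2 y2 * H1 y1 + T1 y1 * H2 y2
        - T1 y1 * T2 y2 * ln 2 + T1 y1 * T2 y2 * renyi_fun 1 (c y1 y2) / 2" for y1 y2
    proof -
      have mult: "L (x * y) = x * L y + y * L x" if "x \<ge> 0" "y \<ge> 0" for x y
        unfolding L_def using x_ln_x_mult[OF that] .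
      have "L (tilt_total 1 (sum_law p1 p2) (0, y1, y2)) + L (tilt_total 1 (sum_law p1 p2) (1, y1, y2))
          = T1 y1 * T2 y2 / 2 * renyi_fun 1 (c y1 y2) + L (T1 y1 * T2 y2) - T1 y1 * T2 y2 * ln 2"
        unfolding tot[unfolded True] L_def by (rule x_ln_x_split[OF TT c])
      then show ?thesis
        by (simp add: H_def H1_def H2_def sum_UNIV_bit pmf_sum_law mult T)
          (simp add: T1 T2 algebra_simps)
    qed
    then have "arimoto_entropy 1 (sum_law p1 p2) = (\<Sum>y1\<in>UNIV. \<Sum>y2\<in>UNIV. T2 y2 * H1 y1 + T1 y1 * H2 y2
        - T1 y1 * T2 y2 * ln 2 + T1 y1 * T2 y2 * renyi_fun 1 (c y1 y2) / 2)"
      unfolding ent sum_UNIV_bit_prod by simp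
    also have "\<dots> = (\<Sum>y\<in>UNIV. T2 y) * (\<Sum>y\<in>UNIV. H1 y) + (\<Sum>y\<in>UNIV. T1 y) * (\<Sum>y\<in>UNIV. H2 y)
        - (\<Sum>y\<in>UNIV. T1 y) * (\<Sum>y\<in>UNIV. T2 y) * ln 2
        + (\<Sum>y1\<in>UNIV. \<Sum>y2\<in>UNIV. T1 y1 * T2 y2 * renyi_fun 1 (c y1 y2)) / 2"
      by (simp add: sum.distrib sum_subtractf sum_divide_distrib flip: sum_distrib_left sum_distrib_right)
    finally show ?thesis unfolding one
      by (simp add: ent True renyi_level_def T1_def T2_def tilt_1 c_def)
  next
    case False
    define \<beta> where "\<beta> = 1 / \<alpha>"
    define K1 where "K1 = (\<Sum>y\<in>UNIV. T1 y powr \<beta>)"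
    define K2 where "K2 = (\<Sum>y\<in>UNIV. T2 y powr \<beta>)"
    define K where "K = (\<Sum>y\<in>UNIV. tilt_total \<alpha> (sum_law p1 p2) y powr \<beta>)"
    define E where "E = (\<Sum>y1\<in>UNIV. \<Sum>y2\<in>UNIV. tilt_weight \<alpha> p1 y1 * tilt_weight \<alpha> p2 y2 * renyi_fun \<beta> (c y1 y2))"
    have pos: "K1 > 0" "K2 > 0" "K > 0"
      unfolding K1_def K2_def K_def T1_def T2_def by (rule sum_tilt_total_pos)+
    have \<beta>: "\<beta> > 0" "\<beta> \<noteq> 1" using \<alpha> False by (auto simp: \<beta>_def)
    \<comment> \<open>For fixed y1, y2 the two values of the sum divide the total T1 y1 * T2 y2 with
      bias c y1 y2, and \<open>renyi_fun_split\<close> recombines them.\<close>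
    have "K = (\<Sum>y1\<in>UNIV. \<Sum>y2\<in>UNIV. (T1 y1 * T2 y2) powr \<beta> * (\<beta> * (\<beta> - 1) * renyi_fun \<beta> (c y1 y2) / 2 powr \<beta>))"
      unfolding K_def sum_UNIV_bit_prod tot renyi_fun_split[OF TT c \<beta>] ..
    also have "\<dots> = K1 * K2 * (\<beta> * (\<beta> - 1) * E / 2 powr \<beta>)"
    proof -
      have "T1 y1 powr \<beta> = K1 * tilt_weight \<alpha> p1 y1" "T2 y2 powr \<beta> = K2 * tilt_weight \<alpha> p2 y2" for y1 y2
        using pos by (simp_all add: tilt_weight_def T1_def T2_def K1_def K2_def \<beta>_def)
      then show ?thesis using T
        by (simp add: E_def sum_distrib_left sum_divide_distrib powr_mult mult_ac)
    qed
    finally have K: "\<beta> * (\<beta> - 1) * E / 2 powr \<beta> = K / (K1 * K2)" using pos by (simp add: field_simps)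
    have "renyi_level \<beta> E = ln (K / (K1 * K2)) / (1 - \<beta>)"
      using \<beta> by (simp only: renyi_level_def K if_False)
    then have "renyi_level \<beta> E = - (ln K1) / (1 - \<beta>) + - (ln K2) / (1 - \<beta>) - - (ln K) / (1 - \<beta>)"
      using pos by (simp add: ln_div ln_mult add_divide_distrib diff_divide_distrib)
    moreover have "arimoto_entropy \<alpha> p1 = - (ln K1) / (1 - \<beta>)" "arimoto_entropy \<alpha> p2 = - (ln K2) / (1 - \<beta>)"
      "arimoto_entropy \<alpha> (sum_law p1 p2) = - (ln K) / (1 - \<beta>)"
      using \<alpha> False by (simp_all add: arimoto_entropy_tilt K1_def K2_def K_def T1_def T2_def \<beta>_def)
    ultimately show ?thesis by (simp add: E_def c_def \<beta>_def)
  qed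
qed

section \<open>The inequality and its equality case\<close>

text \<open>With effective biases \<gamma>, \<delta> for the two pairs, B is the exact entropy
  formula with the mean E of F(b1 b2) replaced by F(\<gamma> \<delta>), so Jensen's inequality
  compares the two. Biases of constant absolute value leave nothing to average.\<close>

lemma arimoto_entropy_sum_law_bound:
  fixes p1 :: "(bit \<times> 'b::finite) pmf" and p2 :: "(bit \<times> 'c::finite) pmf"
  assumes \<alpha>: "\<alpha> > 0"
  defines "B \<equiv> arimoto_entropy \<alpha> p1 + arimoto_entropy \<alpha> p2
            - binary_renyi (1/\<alpha>)
                (binary_renyi_inv (1/\<alpha>) (arimoto_entropy \<alpha> p1)
                   \<star> binary_renyi_inv (1/\<alpha>) (arimoto_entropy \<alpha> p2))"
  shows "(2 - 1 / \<alpha>) * (3 - 1 / \<alpha>) \<ge> 0 \<Longrightarrow> arimoto_entropy \<alpha> (sum_law p1 p2) \<le> B"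
    and "(2 - 1 / \<alpha>) * (3 - 1 / \<alpha>) \<le> 0 \<Longrightarrow> arimoto_entropy \<alpha> (sum_law p1 p2) \<ge> B"
    and "(\<And>y. \<bar>tilt_bias \<alpha> p1 y\<bar> = c1) \<Longrightarrow> (\<And>y. \<bar>tilt_bias \<alpha> p2 y\<bar> = c2) \<Longrightarrow>
         arimoto_entropy \<alpha> (sum_law p1 p2) = B"
proof -
  define \<beta> where "\<beta> = 1 / \<alpha>"
  have \<beta>: "\<beta> > 0" using \<alpha> by (simp add: \<beta>_def)
  define w1 where "w1 = tilt_weight \<alpha> p1"
  define w2 where "w2 = tilt_weight \<alpha> p2"
  \<comment> \<open>Jensen's inequality is available on [0, 1] only; evenness of F permits absolute
    values.\<close>
  define b1 where "b1 = (\<lambda>y. \<bar>tilt_bias \<alpha> p1 y\<bar>)"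
  define b2 where "b2 = (\<lambda>y. \<bar>tilt_bias \<alpha> p2 y\<bar>)"
  have w1: "w1 y \<ge> 0" "sum w1 UNIV = 1" "b1 y \<in> {0..1}" "\<bar>b1 y\<bar> \<le> 1" for y
    by (simp_all add: w1_def b1_def tilt_weight_nonneg sum_tilt_weight abs_tilt_bias_le_1)
  have w2: "w2 y \<ge> 0" "sum w2 UNIV = 1" "b2 y \<in> {0..1}" "\<bar>b2 y\<bar> \<le> 1" for y
    by (simp_all add: w2_def b2_def tilt_weight_nonneg sum_tilt_weight abs_tilt_bias_le_1)
  obtain \<gamma> where \<gamma>: "\<gamma> \<in> {0..1}" "(\<Sum>y\<in>UNIV. w1 y * renyi_fun \<beta> (b1 y)) = renyi_fun \<beta> \<gamma>"
    by (rule renyi_fun_mean[OF \<beta>, of UNIV w1 b1]) (use w1 in auto)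
  obtain \<delta> where \<delta>: "\<delta> \<in> {0..1}" "(\<Sum>y\<in>UNIV. w2 y * renyi_fun \<beta> (b2 y)) = renyi_fun \<beta> \<delta>"
    by (rule renyi_fun_mean[OF \<beta>, of UNIV w2 b2]) (use w2 in auto)
  define E where "E = (\<Sum>y1\<in>UNIV. \<Sum>y2\<in>UNIV. w1 y1 * w2 y2 * renyi_fun \<beta> (b1 y1 * b2 y2))"
  \<comment> \<open>Regarding E as one mean over pairs gives an effective bias \<eta>, as
    \<open>renyi_level_le_iff\<close> compares values of \<open>renyi_fun\<close> only.\<close>
  define W where "W = (\<lambda>(y1, y2). w1 y1 * w2 y2)"
  define C where "C = (\<lambda>(y1, y2). b1 y1 * b2 y2)"
  have E_prod: "E = (\<Sum>z\<in>UNIV. W z * renyi_fun \<beta> (C z))"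
    unfolding E_def W_def C_def by (simp add: sum.cartesian_product case_prod_unfold)
  have "sum W UNIV = sum w1 UNIV * sum w2 UNIV"
    unfolding W_def sum_product by (simp add: sum.cartesian_product case_prod_unfold)
  then have W: "W z \<ge> 0" "sum W UNIV = 1" "\<bar>C z\<bar> \<le> 1" for z
    using w1 w2 by (auto simp: W_def C_def abs_mult mult_le_one split: prod.split)
  obtain \<eta> where \<eta>: "\<eta> \<in> {0..1}" "(\<Sum>z\<in>UNIV. W z * renyi_fun \<beta> (C z)) = renyi_fun \<beta> \<eta>"
    by (rule renyi_fun_mean[OF \<beta>, of UNIV W C]) (use W in auto)
  have E_\<eta>: "E = renyi_fun \<beta> \<eta>" using \<eta>(2) E_prod by simp
  have \<gamma>\<delta>: "\<gamma> * \<delta> \<in> {0..1}" using \<gamma> \<delta> by (auto intro: mult_le_one)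
  have H1: "arimoto_entropy \<alpha> p1 = renyi_level \<beta> (renyi_fun \<beta> \<gamma>)"
    using \<gamma>(2) by (simp add: arimoto_entropy_eq_level[OF \<alpha>] w1_def b1_def \<beta>_def)
  have H2: "arimoto_entropy \<alpha> p2 = renyi_level \<beta> (renyi_fun \<beta> \<delta>)"
    using \<delta>(2) by (simp add: arimoto_entropy_eq_level[OF \<alpha>] w2_def b2_def \<beta>_def)
  have B: "B = arimoto_entropy \<alpha> p1 + arimoto_entropy \<alpha> p2 - renyi_level \<beta> (renyi_fun \<beta> (\<gamma> * \<delta>))"
    unfolding B_def \<beta>_def[symmetric] unfolding H1 H2 binary_renyi_conv_level[OF \<beta> \<gamma>(1) \<delta>(1)] ..
  have H: "arimoto_entropy \<alpha> (sum_law p1 p2) = arimoto_entropy \<alpha> p1 + arimoto_entropy \<alpha> p2 - renyi_level \<beta> E"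
    unfolding arimoto_entropy_sum_law[OF \<alpha>] E_def w1_def w2_def b1_def b2_def \<beta>_def abs_mult[symmetric] renyi_fun_abs ..
  \<comment> \<open>The choices \<sigma> = 1 and \<sigma> = -1 bound E above and below.
    \<open>renyi_level\<close> is decreasing and enters the entropy with a minus sign, so the
    direction is kept.\<close>
  have jensen: "\<sigma> * E \<le> \<sigma> * renyi_fun \<beta> (\<gamma> * \<delta>)" if "\<sigma> * ((2 - \<beta>) * (3 - \<beta>)) \<ge> 0" for \<sigma>
    unfolding E_def by (rule renyi_fun_jensen2[OF that \<beta>]) (use w1 w2 \<gamma> \<delta> in auto)
  show "arimoto_entropy \<alpha> (sum_law p1 p2) \<le> B" if "(2 - 1 / \<alpha>) * (3 - 1 / \<alpha>) \<ge> 0"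
    using jensen[of 1] that renyi_level_le_iff[OF \<beta> \<gamma>\<delta> \<eta>(1)] by (simp add: H B \<beta>_def E_\<eta>)
  show "arimoto_entropy \<alpha> (sum_law p1 p2) \<ge> B" if "(2 - 1 / \<alpha>) * (3 - 1 / \<alpha>) \<le> 0"
    using jensen[of "-1"] that renyi_level_le_iff[OF \<beta> \<eta>(1) \<gamma>\<delta>] by (simp add: H B \<beta>_def E_\<eta>)
  show "arimoto_entropy \<alpha> (sum_law p1 p2) = B"
    if c: "\<And>y. \<bar>tilt_bias \<alpha> p1 y\<bar> = c1" "\<And>y. \<bar>tilt_bias \<alpha> p2 y\<bar> = c2"
  proof -
    have b: "b1 y1 = c1" "b2 y2 = c2" for y1 y2 using c by (simp_all add: b1_def b2_def)
    \<comment> \<open>The mean of a constant is that constant, so injectivity of F on [0, 1]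
      identifies the effective biases.\<close>
    have "renyi_fun \<beta> c1 = renyi_fun \<beta> \<gamma>" "renyi_fun \<beta> c2 = renyi_fun \<beta> \<delta>"
      using \<gamma>(2) \<delta>(2) w1(2) w2(2) by (simp_all add: b flip: sum_distrib_right)
    then have "c1 = \<gamma>" "c2 = \<delta>"
      using \<gamma>(1) \<delta>(1) w1(3) w2(3) \<beta> by (simp_all add: b renyi_fun_eq_iff)
    moreover have "E = renyi_fun \<beta> (c1 * c2)"
      using w1(2) w2(2) by (simp add: E_def b flip: sum_distrib_right sum_distrib_left)
    ultimately show ?thesis by (simp add: H B)
  qed
qed

section \<open>Binary symmetric channels\<close>

lemma pmf_bsc_law:
  assumes "\<epsilon> \<in> {0..1}"
  shows "pmf (bsc_law \<epsilon>) (x, y) = (if x = y then 1 - \<epsilon> else \<epsilon>) / 2"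
proof -
  define f where "f = (\<lambda>(x::bit, n::bit). (x, x + n))"
  have "inj f" by (auto simp: inj_def f_def)
  moreover have "f (x, x + y) = (x, y)" by (cases x; cases y) (auto simp: f_def)
  ultimately have "pmf (bsc_law \<epsilon>) (x, y)
      = pmf (pair_pmf (pmf_of_set UNIV) (map_pmf of_bool (bernoulli_pmf \<epsilon>))) (x, x + y)"
    unfolding bsc_law_def f_def[symmetric] using pmf_map_inj' by metis
  also have "\<dots> = pmf (map_pmf of_bool (bernoulli_pmf \<epsilon>)) (x + y) / 2"
  proof -
    have "card (UNIV :: bit set) = 2" using sum_UNIV_bit[of "\<lambda>_. 1::nat"] by simp
    then show ?thesis by (simp add: pmf_pair)
  qed
  also have "x + y = of_bool (x \<noteq> y)" by (cases x; cases y) auto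
  also have "pmf (map_pmf of_bool (bernoulli_pmf \<epsilon>)) (of_bool (x \<noteq> y) :: bit) = pmf (bernoulli_pmf \<epsilon>) (x \<noteq> y)"
    by (rule pmf_map_inj') (auto simp: inj_def)
  finally show ?thesis using assms by simp
qed

text \<open>Changing the output exchanges the two joint probabilities, which only flips the sign of
  the bias.\<close>

lemma abs_tilt_bias_bsc_law:
  assumes "\<epsilon> \<in> {0..1}"
  shows "\<bar>tilt_bias \<alpha> (bsc_law \<epsilon>) y\<bar> = \<bar>tilt_bias \<alpha> (bsc_law \<epsilon>) 0\<bar>"
  by (cases y) (use assms in \<open>auto simp: tilt_bias_def tilt_total_def pmf_bsc_law abs_minus_commute add.commute\<close>)

theorem mainTheorem3:
  fixes \<alpha> :: real
    and p1 :: "(bit \<times> 'b::finite) pmf"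
    and p2 :: "(bit \<times> 'c::finite) pmf"
  shows
    "(\<alpha> \<in> {0<..1/3} \<union> {1/2..} \<longrightarrow>
        arimoto_entropy \<alpha> (sum_law p1 p2)
          \<le> arimoto_entropy \<alpha> p1 + arimoto_entropy \<alpha> p2
            - binary_renyi (1/\<alpha>)
                (binary_renyi_inv (1/\<alpha>) (arimoto_entropy \<alpha> p1)
                   \<star> binary_renyi_inv (1/\<alpha>) (arimoto_entropy \<alpha> p2)))
     \<and> (\<alpha> \<in> {1/3..1/2} \<longrightarrow>
        arimoto_entropy \<alpha> (sum_law p1 p2)
          \<ge> arimoto_entropy \<alpha> p1 + arimoto_entropy \<alpha> p2
            - binary_renyi (1/\<alpha>)
                (binary_renyi_inv (1/\<alpha>) (arimoto_entropy \<alpha> p1)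
                   \<star> binary_renyi_inv (1/\<alpha>) (arimoto_entropy \<alpha> p2)))
     \<and> (\<alpha> \<in> {1/3, 1/2} \<longrightarrow>
        arimoto_entropy \<alpha> (sum_law p1 p2)
          = arimoto_entropy \<alpha> p1 + arimoto_entropy \<alpha> p2
            - binary_renyi (1/\<alpha>)
                (binary_renyi_inv (1/\<alpha>) (arimoto_entropy \<alpha> p1)
                   \<star> binary_renyi_inv (1/\<alpha>) (arimoto_entropy \<alpha> p2)))
     \<and> (\<alpha> > 0 \<longrightarrow> (\<forall>\<epsilon>1\<in>{0..1}. \<forall>\<epsilon>2\<in>{0..1}.
        arimoto_entropy \<alpha> (sum_law (bsc_law \<epsilon>1) (bsc_law \<epsilon>2))
          = arimoto_entropy \<alpha> (bsc_law \<epsilon>1) + arimoto_entropy \<alpha> (bsc_law \<epsilon>2)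
            - binary_renyi (1/\<alpha>)
                (binary_renyi_inv (1/\<alpha>) (arimoto_entropy \<alpha> (bsc_law \<epsilon>1))
                   \<star> binary_renyi_inv (1/\<alpha>) (arimoto_entropy \<alpha> (bsc_law \<epsilon>2)))))"
proof -
  \<comment> \<open>In \<beta> = 1/\<alpha> the two ranges are \<beta> \<ge> 3 and \<beta> \<le> 2,
    where the factors have equal sign; between 2 and 3 the signs differ.\<close>
  have le: "(2 - 1 / \<alpha>) * (3 - 1 / \<alpha>) \<ge> 0" if "\<alpha> \<in> {0<..1/3} \<union> {1/2..}"
  proof (cases "\<alpha> \<le> 1 / 3")
    case True
    with that have "1 / \<alpha> \<ge> 3" by (auto simp: field_simps)
    then show ?thesis by (intro mult_nonpos_nonpos) auto
  next
    case False
    with that have "1 / \<alpha> \<le> 2" by (auto simp: field_simps)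
    then show ?thesis by (intro mult_nonneg_nonneg) auto
  qed
  have ge: "(2 - 1 / \<alpha>) * (3 - 1 / \<alpha>) \<le> 0" if "\<alpha> \<in> {1/3..1/2}"
  proof -
    have "1 / \<alpha> \<ge> 2" "1 / \<alpha> \<le> 3" using that by (auto simp: field_simps)
    then show ?thesis by (intro mult_nonpos_nonneg) auto
  qed
  show ?thesis
  proof (intro conjI impI ballI, goal_cases)
    case 1
    then show ?case by (intro arimoto_entropy_sum_law_bound(1) le) auto
  next
    case 2
    then show ?case by (intro arimoto_entropy_sum_law_bound(2) ge) auto
  next
    \<comment> \<open>Both endpoints belong to both ranges, so the two inequalities combine.\<close>
    case 3
    then show ?case
      by (intro antisym arimoto_entropy_sum_law_bound(1,2) le ge) auto
  next
    case (4 \<epsilon>1 \<epsilon>2)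
    then show ?case
      by (intro arimoto_entropy_sum_law_bound(3)[OF _ abs_tilt_bias_bsc_law abs_tilt_bias_bsc_law])
  qed
qed

end
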